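(* For any sequence of nested triangles $t_0,t_1,\ldots$ in $M_\kappa^2$ there exist $l_a,L_a>0$ such that, for all $n\in\mathbb N$: (Hyperbolic geometry, $\kappa<0$) $\quad a_0\cdot l_a\le 2^n\cdot a_n\le a_0$, (Spherical geometry, $\kappa>0$) $\quad a_0\le 2^n\cdot a_n\le a_0\cdot L_a$, and similarly for $b_n$ and $c_n$. In addition, in the non-trivial cases where there exists at least some integer $n\in\mathbb N$ such that $a_{n+1}$ is obtained as the parallel side of $a_n$ in $t_{n+1}$, the inequalities are strict and $l_a$ (resp. $L_a$) approaches $1$ from below (resp. above) in the hyperbolic (resp. spherical) setting as all the side lengths of $t_0$ become smaller.
   Context: $M_\kappa^2$ denotes the model surface of constant curvature $\kappa$ (a rescaled hyperbolic plane if $\kappa<0$, a round sphere of radius $1/\sqrt{\kappa}$ if $\kappa>0$). All geodesics are taken to be minimal. A geodesic triangle is a triple of points together with a choice of three geodesic segments joining each pair of points; if $\kappa>0$, the three vertices are moreover required to lie in the same open hemisphere. The medial triangle subdivision of a geodesic triangle is its subdivision into 4 geodesic triangles (one innermost and three outer ones) obtained by pairwise joining the midpoints of its three sides by geodesic segments. A sequence of nested triangles is a sequence of geodesic triangles $t_0,t_1,t_2,\ldots$ such that, for each $n$, $t_{n+1}$ is one of the 4 triangles of the medial triangle subdivision of $t_n$. The sides of $t_n$ (and also their lengths) are denoted $a_n,b_n,c_n$. The sides of $t_0$ are named $a_0,b_0,c_0$, and the names are propagated as follows. (a) If $t_{n+1}$ is the innermost triangle in the medial subdivision of $t_n$, each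 side of $t_{n+1}$ is named after the only side of $t_n$ it does not intersect, e.g. $a_{n+1}$ is the side of $t_{n+1}$ not intersecting $a_n$; in this case $a_{n+1}$ is called the parallel side of $a_n$ in $t_{n+1}$. (b) If $t_{n+1}$ is one of the three outer triangles, the two sides of $t_{n+1}$ that are contained in sides of $t_n$ inherit the letter of the side of $t_n$ containing them, and the remaining side of $t_{n+1}$ is named according to the convention of case (a), i.e. after the side of $t_n$ it does not intersect, and is the parallel side of that side.
   Formalization: Strictness against a_0 is claimed only for n after a parallel step (before it, e.g. at n=0, 2^n a_n = a_0); strictness and l_a<1 (L_a>1) assume t_0 nondegenerate, since for collinear vertices 2^n a_n = a_0 always. *)

theory Defs
  imports "HOL-Analysis.Analysis"
begin

text \<open>The model surface of curvature \<open>\<kappa> \<noteq> 0\<close> is realised in \<open>real^3\<close>: for \<open>\<kappa> > 0\<close> as the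
  round sphere of radius \<open>1 / sqrt \<kappa>\<close>, for \<open>\<kappa> < 0\<close> as the upper sheet of the hyperboloid
  \<open>lorentz x x = 1 / \<kappa>\<close>, each with its intrinsic (great circle / hyperbolic) distance.
  The value \<open>\<kappa> = 0\<close> is not meaningful here.\<close>

definition lorentz :: "real^3 \<Rightarrow> real^3 \<Rightarrow> real" where
  "lorentz x y = x$1 * y$1 + x$2 * y$2 - x$3 * y$3"

definition model_surface :: "real \<Rightarrow> (real^3) set" where
  "model_surface \<kappa> =
     (if \<kappa> > 0 then sphere 0 (1 / sqrt \<kappa>)
      else {x. lorentz x x = 1 / \<kappa> \<and> x$3 > 0})"

definition model_dist :: "real \<Rightarrow> real^3 \<Rightarrow> real^3 \<Rightarrow> real" where
  "model_dist \<kappa> x y =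
     (if \<kappa> > 0 then arccos (\<kappa> * (x \<bullet> y)) / sqrt \<kappa>
      else arcosh (\<kappa> * lorentz x y) / sqrt (- \<kappa>))"

text \<open>Minimal geodesic segments, as images of distance-preserving paths.\<close>

definition geodesic_segment :: "real \<Rightarrow> real^3 \<Rightarrow> real^3 \<Rightarrow> (real^3) set \<Rightarrow> bool" where
  "geodesic_segment \<kappa> p q S \<longleftrightarrow>
     (\<exists>\<gamma>. \<gamma> \<in> {0..model_dist \<kappa> p q} \<rightarrow> model_surface \<kappa> \<and>
          \<gamma> 0 = p \<and> \<gamma> (model_dist \<kappa> p q) = q \<and>
          (\<forall>s\<in>{0..model_dist \<kappa> p q}. \<forall>u\<in>{0..model_dist \<kappa> p q}.
             model_dist \<kappa> (\<gamma> s) (\<gamma> u) = \<bar>s - u\<bar>) \<and>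
          S = \<gamma> ` {0..model_dist \<kappa> p q})"

definition midpoint_of_segment ::
  "real \<Rightarrow> real^3 \<Rightarrow> real^3 \<Rightarrow> (real^3) set \<Rightarrow> real^3 \<Rightarrow> bool" where
  "midpoint_of_segment \<kappa> p q S m \<longleftrightarrow> m \<in> S \<and> model_dist \<kappa> p m = model_dist \<kappa> m q"

text \<open>The labels are the names \<open>a\<close>, \<open>b\<close>, \<open>c\<close> of the sides; \<open>vert t x\<close> is the vertex opposite
  to the side \<open>side t x\<close>.\<close>

datatype label = LA | LB | LC

datatype triangle = Triangle (vert: "label \<Rightarrow> real^3") (side: "label \<Rightarrow> (real^3) set")

definition geodesic_triangle :: "real \<Rightarrow> triangle \<Rightarrow> bool" where
  "geodesic_triangle \<kappa> t \<longleftrightarrow>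
     (\<forall>x. vert t x \<in> model_surface \<kappa>) \<and>
     (\<forall>x y z. distinct [x, y, z] \<longrightarrow> geodesic_segment \<kappa> (vert t y) (vert t z) (side t x)) \<and>
     (\<kappa> > 0 \<longrightarrow> (\<exists>h. \<forall>x. h \<bullet> vert t x > 0))"

definition side_length :: "real \<Rightarrow> triangle \<Rightarrow> label \<Rightarrow> real" where
  "side_length \<kappa> t x =
     (case x of
        LA \<Rightarrow> model_dist \<kappa> (vert t LB) (vert t LC)
      | LB \<Rightarrow> model_dist \<kappa> (vert t LC) (vert t LA)
      | LC \<Rightarrow> model_dist \<kappa> (vert t LA) (vert t LB))"

text \<open>For a triangle whose sides are minimal geodesics (and whose vertices lie in an open
  hemisphere if \<open>\<kappa> > 0\<close>) this says that the vertices do not lie on a common geodesic; in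
  particular they are then distinct.\<close>

definition nondegenerate :: "triangle \<Rightarrow> bool" where
  "nondegenerate t \<longleftrightarrow> (\<forall>x. vert t x \<notin> side t x)"

text \<open>The four pieces of the medial subdivision: the innermost triangle, and for each label
  \<open>x\<close> the outer triangle at the vertex opposite to the side \<open>x\<close>.\<close>

datatype piece = Inner | Outer label

text \<open>\<open>medial_piece \<kappa> t k t'\<close>: the piece \<open>k\<close> of the medial subdivision of \<open>t\<close> is \<open>t'\<close>,
  with the naming of sides induced by \<open>t\<close>. With \<open>m x\<close> the midpoint of side \<open>x\<close> of \<open>t\<close> and
  \<open>x, y, z\<close> distinct, the segment joining \<open>m y\<close> and \<open>m z\<close> meets the sides \<open>y\<close> and \<open>z\<close> of \<open>t\<close>
  but not \<open>x\<close>, so it is named \<open>x\<close>, both in the inner triangle and in the outer triangle at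
  \<open>vert t x\<close>. In the latter, the half of side \<open>y\<close> from \<open>vert t x\<close> to \<open>m y\<close> keeps the name
  \<open>y\<close>; the vertex opposite to it is \<open>m z\<close>.\<close>

definition medial_piece :: "real \<Rightarrow> triangle \<Rightarrow> piece \<Rightarrow> triangle \<Rightarrow> bool" where
  "medial_piece \<kappa> t k t' \<longleftrightarrow>
     geodesic_triangle \<kappa> t' \<and>
     (\<exists>m.
        (\<forall>x y z. distinct [x, y, z] \<longrightarrow>
           midpoint_of_segment \<kappa> (vert t y) (vert t z) (side t x) (m x)) \<and>
        (case k of
           Inner \<Rightarrow> (\<forall>x. vert t' x = m x)
         | Outer x \<Rightarrow>
             vert t' x = vert t x \<and>
             (\<forall>y z. distinct [x, y, z] \<longrightarrow> vert t' y = m z \<and> side t' y \<subseteq> side t y)))"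

definition nested_triangles :: "real \<Rightarrow> (nat \<Rightarrow> triangle) \<Rightarrow> bool" where
  "nested_triangles \<kappa> t \<longleftrightarrow>
     (\<forall>n. geodesic_triangle \<kappa> (t n)) \<and> (\<forall>n. \<exists>k. medial_piece \<kappa> (t n) k (t (Suc n)))"

text \<open>Side \<open>x\<close> of \<open>t (Suc n)\<close> is obtained as the parallel side of side \<open>x\<close> of \<open>t n\<close>.\<close>

definition parallel_step :: "real \<Rightarrow> (nat \<Rightarrow> triangle) \<Rightarrow> label \<Rightarrow> nat \<Rightarrow> bool" where
  "parallel_step \<kappa> t x n \<longleftrightarrow>
     medial_piece \<kappa> (t n) Inner (t (Suc n)) \<or> medial_piece \<kappa> (t n) (Outer x) (t (Suc n))"

end

theory Submission
  imports Defs
begin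

text \<open>
  With \<open>\<kappa>\<close> times the ambient bilinear form in place of the scalar product, points of either surface
  are unit vectors and the form of two points is \<open>C d\<close>, where \<open>d\<close> is their distance in units of the
  curvature radius (the unit of all lengths here) and \<open>C\<close> is \<open>cos\<close> or \<open>cosh\<close>. The midpoint of \<open>u\<close> and \<open>v\<close> is \<open>(u + v) / (2 C (d / 2))\<close>,
  so the parallel side \<open>a'\<close> of \<open>a\<close> satisfies
  \<open>4 C (b / 2) C (c / 2) C a' = 1 + C a + C b + C c\<close>. Everything follows from this formula.

  \<^emph>\<open>Monotonicity.\<close> The difference of \<open>C (a / 2)\<close> and \<open>C a'\<close> is, up to a positive factor, the Gram
  determinant of a triangle with sides \<open>a / 2\<close>, \<open>b / 2\<close>, \<open>c / 2\<close>. This determinant factors, like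
  Heron's formula, into terms controlled by the triangle inequalities
  (\<open>gram_factor\<close>, \<open>parallel_side_vs_half\<close>). Hence \<open>2 a' \<le> a\<close> in the hyperbolic and
  \<open>a \<le> 2 a'\<close> in the spherical case, with equality only for degenerate triangles. Nondegeneracy is
  the nonvanishing of the determinant of the three vertices, and this passes to the medial pieces
  because their vertices arise from the old ones by an invertible linear substitution.

  \<^emph>\<open>Hyperbolic lower bound.\<close> Dropping a square in the formula gives \<open>2 a' \<ge> a * exp (- P)\<close> with
  the perimeter \<open>P\<close>. By monotonicity perimeters are at least halved in every step, so the exponents
  form a geometric series of sum at most \<open>2 P\<^sub>0\<close>.

  \<^emph>\<open>Spherical upper bound.\<close> Sides need not shrink by a fixed factor here: near a great circle a medial
  triangle is hardly smaller than the original. But the vertices stay in a fixed cap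
  of an open hemisphere, and central projection of that cap to a plane turns geodesic midpoints into
  convex combinations with weights bounded away from \<open>0\<close> and \<open>1\<close>. The diameter of the projected
  triangle therefore decays geometrically (\<open>chart_bounded_medial\<close>), and since
  \<open>2 a' \<le> a * exp (const * diameter)\<close>, the exponents are again summable. The constant depends only on
  the distance from the cap to the boundary of the hemisphere; for small triangles the hemisphere around a vertex
  gives a universal one, so that the factor tends to \<open>1\<close>.
\<close>

section \<open>The ambient bilinear form\<close>

text \<open>The factor \<open>\<kappa>\<close> gives the points of the surface square \<open>1\<close> for either sign of the curvature, and the
  factor \<open>sgn \<kappa>\<close> selects the Euclidean or the Lorentz form, so that both geometries
  share one set of formulas.\<close>
definition form :: "real \<Rightarrow> real^3 \<Rightarrow> real^3 \<Rightarrow> real" where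
  "form \<kappa> x y = \<kappa> * (x$1 * y$1 + x$2 * y$2 + sgn \<kappa> * (x$3 * y$3))"

definition gcos :: "real \<Rightarrow> real \<Rightarrow> real" where
  "gcos \<kappa> \<theta> = (if \<kappa> > 0 then cos \<theta> else cosh \<theta>)"

definition gsin :: "real \<Rightarrow> real \<Rightarrow> real" where
  "gsin \<kappa> \<theta> = (if \<kappa> > 0 then sin \<theta> else sinh \<theta>)"

text \<open>The distance in units of the curvature radius.\<close>
definition scaled_dist :: "real \<Rightarrow> real^3 \<Rightarrow> real^3 \<Rightarrow> real" where
  "scaled_dist \<kappa> x y = sqrt \<bar>\<kappa>\<bar> * model_dist \<kappa> x y"

definition det3 :: "real^3 \<Rightarrow> real^3 \<Rightarrow> real^3 \<Rightarrow> real" where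
  "det3 u v w =
     u$1 * (v$2 * w$3 - v$3 * w$2) - u$2 * (v$1 * w$3 - v$3 * w$1) + u$3 * (v$1 * w$2 - v$2 * w$1)"

lemma form_inner: "\<kappa> > 0 \<Longrightarrow> form \<kappa> x y = \<kappa> * (x \<bullet> y)"
  by (simp add: form_def inner_vec_def sum_3)

lemma form_lorentz: "\<kappa> < 0 \<Longrightarrow> form \<kappa> x y = \<kappa> * lorentz x y"
  by (simp add: form_def lorentz_def)

lemma form_sym: "form \<kappa> x y = form \<kappa> y x"
  by (simp add: form_def mult.commute)

lemma form_linear:
  "form \<kappa> (x + y) z = form \<kappa> x z + form \<kappa> y z"
  "form \<kappa> z (x + y) = form \<kappa> z x + form \<kappa> z y"
  "form \<kappa> (x - y) z = form \<kappa> x z - form \<kappa> y z"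
  "form \<kappa> z (x - y) = form \<kappa> z x - form \<kappa> z y"
  "form \<kappa> (r *\<^sub>R x) z = r * form \<kappa> x z"
  "form \<kappa> z (r *\<^sub>R x) = r * form \<kappa> z x"
  by (simp_all add: form_def algebra_simps)

lemma model_dist_sym: "model_dist \<kappa> x y = model_dist \<kappa> y x"
  by (simp add: model_dist_def lorentz_def inner_commute mult.commute)

lemma scaled_dist_sym: "scaled_dist \<kappa> x y = scaled_dist \<kappa> y x"
  by (simp add: scaled_dist_def model_dist_sym)

lemma form_self:
  assumes "\<kappa> \<noteq> 0" "x \<in> model_surface \<kappa>"
  shows "form \<kappa> x x = 1"
proof (cases "\<kappa> > 0")
  case True
  then have "norm x = 1 / sqrt \<kappa>" using assms(2) by (simp add: model_surface_def)
  then have "x \<bullet> x = 1 / \<kappa>" using True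
    by (simp add: dot_square_norm power_divide)
  then show ?thesis using True by (simp add: form_inner)
next
  case False
  then show ?thesis using assms by (simp add: form_lorentz model_surface_def)
qed

text \<open>The reversed Cauchy--Schwarz inequality of the hyperboloid. It is what makes \<open>cosh\<close> invert \<open>arcosh\<close> in the
  definition of the hyperbolic distance.\<close>
lemma form_ge_1:
  assumes "\<kappa> < 0" "x \<in> model_surface \<kappa>" "y \<in> model_surface \<kappa>"
  shows "form \<kappa> x y \<ge> 1"
proof -
  define r where "r = - 1 / \<kappa>"
  have r: "r > 0" "\<kappa> * r = - 1" using assms by (auto simp: r_def divide_pos_neg)
  have x: "x$3 * x$3 = r + (x$1 * x$1 + x$2 * x$2)" "x$3 > 0"
    and y: "y$3 * y$3 = r + (y$1 * y$1 + y$2 * y$2)" "y$3 > 0"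
    using assms by (auto simp: model_surface_def lorentz_def r_def)
  have "(r + (x$1 * y$1 + x$2 * y$2))\<^sup>2 \<le>
      (r + (x$1 * x$1 + x$2 * x$2)) * (r + (y$1 * y$1 + y$2 * y$2))"
  proof -
    \<comment> \<open>Lagrange's identity for the vectors \<open>(sqrt r, x$1, x$2)\<close> and \<open>(sqrt r, y$1, y$2)\<close>.\<close>
    have "(r + (x$1 * x$1 + x$2 * x$2)) * (r + (y$1 * y$1 + y$2 * y$2))
       - (r + (x$1 * y$1 + x$2 * y$2))\<^sup>2
       = r * ((x$1 - y$1)\<^sup>2 + (x$2 - y$2)\<^sup>2) + (x$1 * y$2 - x$2 * y$1)\<^sup>2"
      by algebra
    also have "\<dots> \<ge> 0" using r by (intro add_nonneg_nonneg mult_nonneg_nonneg) auto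
    finally show ?thesis by simp
  qed
  also have "\<dots> = (x$3 * y$3)\<^sup>2" unfolding x(1)[symmetric] y(1)[symmetric]
    by (simp add: power2_eq_square)
  finally have "r + (x$1 * y$1 + x$2 * y$2) \<le> x$3 * y$3"
    using x(2) y(2) by (meson less_imp_le mult_pos_pos power2_le_imp_le)
  then have "- \<kappa> * r \<le> - \<kappa> * (x$3 * y$3 - (x$1 * y$1 + x$2 * y$2))"
    using assms(1) by (intro mult_left_mono) auto
  then show ?thesis using r assms(1) by (simp add: form_def algebra_simps)
qed

lemma form_abs_le_1:
  assumes "\<kappa> > 0" "x \<in> model_surface \<kappa>" "y \<in> model_surface \<kappa>"
  shows "\<bar>form \<kappa> x y\<bar> \<le> 1"
proof -
  have "norm x = 1 / sqrt \<kappa>" "norm y = 1 / sqrt \<kappa>"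
    using assms by (auto simp: model_surface_def)
  then have "\<bar>x \<bullet> y\<bar> \<le> 1 / \<kappa>" using Cauchy_Schwarz_ineq2[of x y] assms(1) by simp
  then show ?thesis using assms(1) by (simp add: form_inner abs_mult field_simps)
qed

lemma scaled_dist_eq:
  assumes "\<kappa> \<noteq> 0"
  shows "scaled_dist \<kappa> x y = (if \<kappa> > 0 then arccos (form \<kappa> x y) else arcosh (form \<kappa> x y))"
  using assms by (auto simp: scaled_dist_def model_dist_def form_inner form_lorentz)

lemma form_eq_gcos:
  assumes "\<kappa> \<noteq> 0" "x \<in> model_surface \<kappa>" "y \<in> model_surface \<kappa>"
  shows "form \<kappa> x y = gcos \<kappa> (scaled_dist \<kappa> x y)"
proof (cases "\<kappa> > 0")
  case True
  then show ?thesis using form_abs_le_1[OF True assms(2,3)] by (simp add: scaled_dist_eq gcos_def)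
next
  case False
  then show ?thesis using form_ge_1[OF _ assms(2,3)] assms(1)
    by (simp add: scaled_dist_eq gcos_def cosh_arcosh_real)
qed

lemma scaled_dist_bounds:
  assumes "\<kappa> \<noteq> 0" "x \<in> model_surface \<kappa>" "y \<in> model_surface \<kappa>"
  shows "0 \<le> scaled_dist \<kappa> x y" "\<kappa> > 0 \<Longrightarrow> scaled_dist \<kappa> x y \<le> pi"
proof -
  show "0 \<le> scaled_dist \<kappa> x y"
  proof (cases "\<kappa> > 0")
    case True
    then show ?thesis using form_abs_le_1[OF True assms(2,3)] by (simp add: scaled_dist_eq arccos_lbound)
  next
    case False
    then show ?thesis using form_ge_1[OF _ assms(2,3)] assms(1)
      by (simp add: scaled_dist_eq arcosh_nonneg_real)
  qed
  show "\<kappa> > 0 \<Longrightarrow> scaled_dist \<kappa> x y \<le> pi"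
    using form_abs_le_1[OF _ assms(2,3)] by (simp add: scaled_dist_eq arccos_ubound)
qed

text \<open>The form is definite on the tangent plane at \<open>m\<close>. This is the means to prove vector identities below: it
  suffices to compare scalar products.\<close>
lemma null_orthogonal_eq_0:
  assumes "\<kappa> \<noteq> 0" "m \<in> model_surface \<kappa>" "form \<kappa> n m = 0" "form \<kappa> n n = 0"
  shows "n = 0"
proof (cases "\<kappa> > 0")
  case True
  then show ?thesis using assms(4) by (simp add: form_inner)
next
  case False
  then have k: "\<kappa> < 0" using assms(1) by simp
  define r where "r = - 1 / \<kappa>"
  have r: "r > 0" using k by (auto simp: r_def divide_pos_neg)
  have m: "m$3 * m$3 = r + (m$1 * m$1 + m$2 * m$2)"
    using assms k by (auto simp: model_surface_def lorentz_def r_def)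
  have 1: "n$1 * m$1 + n$2 * m$2 = n$3 * m$3" and 2: "n$1 * n$1 + n$2 * n$2 = n$3 * n$3"
    using assms(3,4) k by (auto simp: form_def)
  \<comment> \<open>Lagrange's identity for the first two coordinates of \<open>n\<close> and \<open>m\<close>.\<close>
  have "(n$3)\<^sup>2 * r + (n$1 * m$2 - n$2 * m$1)\<^sup>2 = 0" using m 1 2 by algebra
  moreover have "(n$3)\<^sup>2 * r \<ge> 0" using r by simp
  ultimately have "(n$3)\<^sup>2 * r = 0" using zero_le_power2[of "n$1 * m$2 - n$2 * m$1"] by linarith
  then have "n$3 = 0" using r by simp
  with 2 have "n$1 = 0" "n$2 = 0" by (auto simp: sum_squares_eq_zero_iff)
  with \<open>n$3 = 0\<close> show ?thesis by (simp add: vec_eq_iff forall_3)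
qed

text \<open>The Gram determinant of three vectors is the square of their determinant times the determinant of the
  form, which is positive for both signatures.\<close>
lemma gram_det3:
  assumes "\<kappa> \<noteq> 0" "form \<kappa> u u = 1" "form \<kappa> v v = 1" "form \<kappa> w w = 1"
  shows "1 - (form \<kappa> v w)\<^sup>2 - (form \<kappa> w u)\<^sup>2 - (form \<kappa> u v)\<^sup>2
      + 2 * form \<kappa> v w * form \<kappa> w u * form \<kappa> u v = \<bar>\<kappa>\<bar> ^ 3 * (det3 u v w)\<^sup>2"
proof -
  have "form \<kappa> u u * form \<kappa> v v * form \<kappa> w w - form \<kappa> u u * (form \<kappa> v w)\<^sup>2
      - form \<kappa> v v * (form \<kappa> w u)\<^sup>2 - form \<kappa> w w * (form \<kappa> u v)\<^sup>2
      + 2 * form \<kappa> v w * form \<kappa> w u * form \<kappa> u v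
      = sgn \<kappa> * \<kappa> ^ 3 * (det3 u v w)\<^sup>2"
    unfolding form_def det3_def by algebra
  moreover have "sgn \<kappa> * \<kappa> ^ 3 = \<bar>\<kappa>\<bar> ^ 3"
    using assms(1) by (auto simp: sgn_if abs_if power3_eq_cube)
  ultimately show ?thesis using assms by simp
qed

lemma gcos_double: "gcos \<kappa> (2 * \<theta>) = 2 * (gcos \<kappa> \<theta>)\<^sup>2 - 1"
  by (simp add: gcos_def cos_double_cos cosh_double_cosh)

lemma gcos_pyth: "(gcos \<kappa> \<theta>)\<^sup>2 + (if \<kappa> > 0 then 1 else -1) * (gsin \<kappa> \<theta>)\<^sup>2 = 1"
  by (simp add: gcos_def gsin_def hyperbolic_pythagoras)

text \<open>This factorization links the Gram determinant to the triangle inequalities: its factors vanish exactly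
  when one side is the sum or the difference of the others (up to full turns on the sphere).\<close>
lemma gram_factor:
  "1 - (gcos \<kappa> a)\<^sup>2 - (gcos \<kappa> b)\<^sup>2 - (gcos \<kappa> c)\<^sup>2 + 2 * gcos \<kappa> a * gcos \<kappa> b * gcos \<kappa> c
   = (gcos \<kappa> (b - c) - gcos \<kappa> a) * (gcos \<kappa> a - gcos \<kappa> (b + c))"
proof (cases "\<kappa> > 0")
  case True
  have "1 - (cos a)\<^sup>2 - (cos b)\<^sup>2 - (cos c)\<^sup>2 + 2 * cos a * cos b * cos c
      = (cos b * cos c + sin b * sin c - cos a) * (cos a - (cos b * cos c - sin b * sin c))"
    using sin_cos_squared_add[of b] sin_cos_squared_add[of c] by algebra
  with True show ?thesis by (simp add: gcos_def cos_add cos_diff)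
next
  case False
  have "1 - (cosh a)\<^sup>2 - (cosh b)\<^sup>2 - (cosh c)\<^sup>2 + 2 * cosh a * cosh b * cosh c
      = (cosh b * cosh c - sinh b * sinh c - cosh a) * (cosh a - (cosh b * cosh c + sinh b * sinh c))"
    using hyperbolic_pythagoras[of b] hyperbolic_pythagoras[of c] by algebra
  with False show ?thesis by (simp add: gcos_def cosh_add cosh_diff)
qed

lemma gcos_inj:
  assumes "0 \<le> a" "0 \<le> b" "\<kappa> > 0 \<Longrightarrow> a \<le> pi" "\<kappa> > 0 \<Longrightarrow> b \<le> pi" "gcos \<kappa> a = gcos \<kappa> b"
  shows "a = b"
proof (cases "\<kappa> > 0")
  case True
  then show ?thesis using assms by (metis gcos_def cos_inj_pi)
next
  case False
  then show ?thesis using assms by (metis gcos_def arcosh_cosh_real)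
qed

lemma scaled_dist_eq_0_iff:
  assumes "\<kappa> \<noteq> 0" "x \<in> model_surface \<kappa>" "y \<in> model_surface \<kappa>"
  shows "scaled_dist \<kappa> x y = 0 \<longleftrightarrow> x = y"
proof
  assume "scaled_dist \<kappa> x y = 0"
  then have 1: "form \<kappa> x y = 1" using form_eq_gcos[OF assms] by (simp add: gcos_def)
  have "x - y = 0"
    by (rule null_orthogonal_eq_0[OF assms(1,2)])
      (use 1 form_sym[of \<kappa> x y] form_self[OF assms(1,2)] form_self[OF assms(1,3)] in
        \<open>simp_all add: form_linear\<close>)
  then show "x = y" by simp
next
  assume "x = y"
  then show "scaled_dist \<kappa> x y = 0" using form_self[OF assms(1,2)] assms(1)
    by (simp add: scaled_dist_eq)
qed

section \<open>Midpoints of geodesics\<close>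

text \<open>The difference of the two sides of the vector identity is orthogonal to \<open>m\<close> and null, because all scalar
  products among \<open>p\<close>, \<open>q\<close>, \<open>m\<close> are determined by the distances.\<close>
lemma midpoint_vector:
  assumes "\<kappa> \<noteq> 0" "p \<in> model_surface \<kappa>" "q \<in> model_surface \<kappa>"
    and "geodesic_segment \<kappa> p q S" "midpoint_of_segment \<kappa> p q S m"
  shows "m \<in> model_surface \<kappa>" "scaled_dist \<kappa> p m = scaled_dist \<kappa> p q / 2" "scaled_dist \<kappa> q m = scaled_dist \<kappa> p q / 2"
    "(2 * gcos \<kappa> (scaled_dist \<kappa> p q / 2)) *\<^sub>R m = p + q"
proof -
  define D where "D = model_dist \<kappa> p q"
  obtain g where g: "g \<in> {0..D} \<rightarrow> model_surface \<kappa>" "g 0 = p" "g D = q"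
    "\<forall>s\<in>{0..D}. \<forall>u\<in>{0..D}. model_dist \<kappa> (g s) (g u) = \<bar>s - u\<bar>" "S = g ` {0..D}"
    using assms(4) unfolding geodesic_segment_def D_def by blast
  obtain s where s: "s \<in> {0..D}" "m = g s"
    using assms(5) g(5) by (auto simp: midpoint_of_segment_def)
  show m: "m \<in> model_surface \<kappa>" using s g(1) by auto
  have "0 \<in> {0..D}" "D \<in> {0..D}" using s(1) by auto
  then have "model_dist \<kappa> p m = s" "model_dist \<kappa> m q = D - s"
    using g(2,3,4) s by fastforce+
  moreover have "model_dist \<kappa> p m = model_dist \<kappa> m q"
    using assms(5) by (simp add: midpoint_of_segment_def)
  ultimately have "model_dist \<kappa> p m = D / 2" "model_dist \<kappa> q m = D / 2"
    by (auto simp: model_dist_sym[of \<kappa> q])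
  then show 1: "scaled_dist \<kappa> p m = scaled_dist \<kappa> p q / 2" and 2: "scaled_dist \<kappa> q m = scaled_dist \<kappa> p q / 2"
    by (simp_all add: scaled_dist_def D_def)
  define c where "c = gcos \<kappa> (scaled_dist \<kappa> p q / 2)"
  have f: "form \<kappa> p m = c" "form \<kappa> q m = c" "form \<kappa> m p = c" "form \<kappa> m q = c"
    using form_eq_gcos[OF assms(1,2) m] form_eq_gcos[OF assms(1,3) m] 1 2
    by (auto simp: c_def form_sym[of \<kappa> m])
  have pq: "form \<kappa> p q = 2 * c\<^sup>2 - 1" "form \<kappa> q p = 2 * c\<^sup>2 - 1"
    using form_eq_gcos[OF assms(1-3)] gcos_double[of \<kappa> "scaled_dist \<kappa> p q / 2"]
    by (auto simp: c_def form_sym[of \<kappa> q])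
  have "(2 * c) *\<^sub>R m - p - q = 0"
  proof (rule null_orthogonal_eq_0[OF assms(1) m])
    show "form \<kappa> ((2 * c) *\<^sub>R m - p - q) m = 0"
      using form_self[OF assms(1) m] f by (simp add: form_linear)
    show "form \<kappa> ((2 * c) *\<^sub>R m - p - q) ((2 * c) *\<^sub>R m - p - q) = 0"
      using form_self[OF assms(1) m] form_self[OF assms(1,2)] form_self[OF assms(1,3)] f pq
      by (simp add: form_linear algebra_simps power2_eq_square)
  qed
  then show "(2 * gcos \<kappa> (scaled_dist \<kappa> p q / 2)) *\<^sub>R m = p + q" by (simp add: c_def algebra_simps)
qed

text \<open>Expand the form of \<open>u + v\<close> and \<open>u + w\<close>, which are multiples of the midpoints.\<close>
lemma parallel_side_gcos:
  assumes "\<kappa> \<noteq> 0" "u \<in> model_surface \<kappa>" "v \<in> model_surface \<kappa>" "w \<in> model_surface \<kappa>"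
    and "m \<in> model_surface \<kappa>" "m' \<in> model_surface \<kappa>"
    and "(2 * gcos \<kappa> (scaled_dist \<kappa> u v / 2)) *\<^sub>R m = u + v"
    and "(2 * gcos \<kappa> (scaled_dist \<kappa> u w / 2)) *\<^sub>R m' = u + w"
  shows "4 * gcos \<kappa> (scaled_dist \<kappa> u v / 2) * gcos \<kappa> (scaled_dist \<kappa> u w / 2) * gcos \<kappa> (scaled_dist \<kappa> m m')
      = 1 + gcos \<kappa> (scaled_dist \<kappa> u v) + gcos \<kappa> (scaled_dist \<kappa> u w) + gcos \<kappa> (scaled_dist \<kappa> v w)"
proof -
  have "form \<kappa> ((2 * gcos \<kappa> (scaled_dist \<kappa> u v / 2)) *\<^sub>R m) ((2 * gcos \<kappa> (scaled_dist \<kappa> u w / 2)) *\<^sub>R m')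
    = form \<kappa> (u + v) (u + w)" using assms(7,8) by simp
  moreover have "form \<kappa> u u = 1" "form \<kappa> v u = form \<kappa> u v"
    using form_self[OF assms(1,2)] form_sym[of \<kappa> v u] by simp_all
  ultimately show ?thesis
    using form_eq_gcos[OF assms(1,5,6)] form_eq_gcos[OF assms(1,2,3)]
      form_eq_gcos[OF assms(1,2,4)] form_eq_gcos[OF assms(1,3,4)]
    by (simp add: form_linear algebra_simps)
qed

section \<open>Degenerate triangles\<close>

lemma gcos_abs: "gcos \<kappa> \<bar>\<theta>\<bar> = gcos \<kappa> \<theta>"
  by (simp add: gcos_def)

lemma gsin_add: "gsin \<kappa> (a + b) = gsin \<kappa> a * gcos \<kappa> b + gcos \<kappa> a * gsin \<kappa> b"
  by (simp add: gcos_def gsin_def sin_add sinh_add)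

lemma gcos_add: "gcos \<kappa> (a + b) = gcos \<kappa> a * gcos \<kappa> b - (if \<kappa> > 0 then 1 else -1) * gsin \<kappa> a * gsin \<kappa> b"
  by (simp add: gcos_def gsin_def cos_add cosh_add)

text \<open>A point \<open>r\<close> between \<open>p\<close> and \<open>q\<close> is determined by its distances to them. The difference of the two
  sides is orthogonal to \<open>p\<close>, \<open>q\<close> and \<open>r\<close>, hence null and tangent at \<open>r\<close>.\<close>
lemma geodesic_point_vector:
  assumes "\<kappa> \<noteq> 0" "p \<in> model_surface \<kappa>" "q \<in> model_surface \<kappa>" "r \<in> model_surface \<kappa>"
    and "scaled_dist \<kappa> p q = scaled_dist \<kappa> p r + scaled_dist \<kappa> r q"
  shows "gsin \<kappa> (scaled_dist \<kappa> p q) *\<^sub>R r = gsin \<kappa> (scaled_dist \<kappa> r q) *\<^sub>R p + gsin \<kappa> (scaled_dist \<kappa> p r) *\<^sub>R q"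
proof -
  define b c where "b = scaled_dist \<kappa> r q" and "c = scaled_dist \<kappa> p r"
  define N where "N = gsin \<kappa> (b + c) *\<^sub>R r - gsin \<kappa> b *\<^sub>R p - gsin \<kappa> c *\<^sub>R q"
  have f: "form \<kappa> p q = gcos \<kappa> (b + c)" "form \<kappa> q p = gcos \<kappa> (b + c)"
      "form \<kappa> p r = gcos \<kappa> c" "form \<kappa> r p = gcos \<kappa> c" "form \<kappa> q r = gcos \<kappa> b" "form \<kappa> r q = gcos \<kappa> b"
      "form \<kappa> p p = 1" "form \<kappa> q q = 1" "form \<kappa> r r = 1"
    using form_eq_gcos[OF assms(1,2,3)] form_eq_gcos[OF assms(1,2,4)]
      form_eq_gcos[OF assms(1,4,3)] form_self[OF assms(1)] assms(2-5)
    by (auto simp: b_def c_def form_sym[of \<kappa> q p] form_sym[of \<kappa> q r] form_sym[of \<kappa> r p] add.commute)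
  have Nr: "form \<kappa> N r = 0"
    by (simp add: N_def form_linear f gsin_add)
  have Np: "form \<kappa> N p = 0" and Nq: "form \<kappa> N q = 0"
  proof -
    define s :: real where "s = (if \<kappa> > 0 then 1 else -1)"
    have p: "(gcos \<kappa> b)\<^sup>2 = 1 - s * (gsin \<kappa> b)\<^sup>2" "(gcos \<kappa> c)\<^sup>2 = 1 - s * (gsin \<kappa> c)\<^sup>2"
      using gcos_pyth[of \<kappa> b] gcos_pyth[of \<kappa> c] by (simp_all add: s_def)
    have "form \<kappa> N p = (gsin \<kappa> b * gcos \<kappa> c + gcos \<kappa> b * gsin \<kappa> c) * gcos \<kappa> c - gsin \<kappa> b
        - gsin \<kappa> c * (gcos \<kappa> b * gcos \<kappa> c - s * gsin \<kappa> b * gsin \<kappa> c)"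
      by (simp add: N_def form_linear f gsin_add gcos_add s_def)
    also have "\<dots> = gsin \<kappa> b * (gcos \<kappa> c)\<^sup>2 - gsin \<kappa> b + s * gsin \<kappa> b * (gsin \<kappa> c)\<^sup>2"
      by (simp add: algebra_simps power2_eq_square)
    also have "\<dots> = 0" unfolding p by (simp add: algebra_simps)
    finally show "form \<kappa> N p = 0" .
    have "form \<kappa> N q = (gsin \<kappa> b * gcos \<kappa> c + gcos \<kappa> b * gsin \<kappa> c) * gcos \<kappa> b
        - gsin \<kappa> b * (gcos \<kappa> b * gcos \<kappa> c - s * gsin \<kappa> b * gsin \<kappa> c) - gsin \<kappa> c"
      by (simp add: N_def form_linear f gsin_add gcos_add s_def)
    also have "\<dots> = gsin \<kappa> c * (gcos \<kappa> b)\<^sup>2 - gsin \<kappa> c + s * gsin \<kappa> c * (gsin \<kappa> b)\<^sup>2"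
      by (simp add: algebra_simps power2_eq_square)
    also have "\<dots> = 0" unfolding p by (simp add: algebra_simps)
    finally show "form \<kappa> N q = 0" .
  qed
  have "form \<kappa> N N = gsin \<kappa> (b + c) * form \<kappa> N r - gsin \<kappa> b * form \<kappa> N p - gsin \<kappa> c * form \<kappa> N q"
    by (simp only: N_def form_linear)
  then have "form \<kappa> N N = 0" by (simp add: Nr Np Nq)
  then have "N = 0" using null_orthogonal_eq_0[OF assms(1,4) Nr] by simp
  then show ?thesis using assms(5) by (simp add: N_def b_def c_def algebra_simps)
qed

text \<open>Between endpoints that are not antipodal, any point for which the triangle inequality is an equality lies on
  the given minimal segment: the point of
  the segment at the same distance from \<open>p\<close> satisfies the same formula \<open>geodesic_point_vector\<close>.\<close>
lemma between_in_segment: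
  assumes "\<kappa> \<noteq> 0" "p \<in> model_surface \<kappa>" "q \<in> model_surface \<kappa>" "r \<in> model_surface \<kappa>"
    and seg: "geodesic_segment \<kappa> p q S"
    and btw: "scaled_dist \<kappa> p q = scaled_dist \<kappa> p r + scaled_dist \<kappa> r q" and lt: "\<kappa> > 0 \<Longrightarrow> scaled_dist \<kappa> p q < pi"
  shows "r \<in> S"
proof -
  define D where "D = model_dist \<kappa> p q"
  have k: "sqrt \<bar>\<kappa>\<bar> > 0" using assms(1) by simp
  have nn: "0 \<le> model_dist \<kappa> x y" if "x \<in> model_surface \<kappa>" "y \<in> model_surface \<kappa>" for x y
    using scaled_dist_bounds(1)[OF assms(1) that] k by (simp add: scaled_dist_def zero_le_mult_iff)
  obtain g where g: "g \<in> {0..D} \<rightarrow> model_surface \<kappa>" "g 0 = p" "g D = q"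
    "\<forall>s\<in>{0..D}. \<forall>u\<in>{0..D}. model_dist \<kappa> (g s) (g u) = \<bar>s - u\<bar>" "S = g ` {0..D}"
    using seg unfolding geodesic_segment_def D_def by blast
  define s where "s = model_dist \<kappa> p r"
  have Ds: "D = s + model_dist \<kappa> r q"
    using btw k unfolding scaled_dist_def D_def s_def
    by (simp only: distrib_left[symmetric] mult_cancel_left) auto
  have s: "s \<in> {0..D}" using nn assms(2-4) Ds by (auto simp: s_def)
  have ends: "0 \<in> {0..D}" "D \<in> {0..D}" using s by auto
  have r': "g s \<in> model_surface \<kappa>" using g(1) s by auto
  have "model_dist \<kappa> p (g s) = s" "model_dist \<kappa> (g s) q = model_dist \<kappa> r q"
    using g(2,3,4) s ends Ds by fastforce+
  then have a: "scaled_dist \<kappa> p (g s) = scaled_dist \<kappa> p r" "scaled_dist \<kappa> (g s) q = scaled_dist \<kappa> r q"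
    by (simp_all add: scaled_dist_def s_def)
  have "r = g s"
  proof (cases "scaled_dist \<kappa> p q = 0")
    case True
    then have "scaled_dist \<kappa> p r = 0" using btw scaled_dist_bounds(1)[OF assms(1)] assms(2-4) by (smt (verit))
    then show ?thesis using a scaled_dist_eq_0_iff[OF assms(1)] assms(2,4) r' by metis
  next
    case False
    then have pos: "scaled_dist \<kappa> p q > 0" using scaled_dist_bounds(1)[OF assms(1-3)] by simp
    then have "gsin \<kappa> (scaled_dist \<kappa> p q) \<noteq> 0"
      using lt sin_gt_zero[of "scaled_dist \<kappa> p q"] by (auto simp: gsin_def)
    moreover have "gsin \<kappa> (scaled_dist \<kappa> p q) *\<^sub>R r = gsin \<kappa> (scaled_dist \<kappa> p q) *\<^sub>R g s"
      using geodesic_point_vector[OF assms(1-3) assms(4) btw]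
        geodesic_point_vector[OF assms(1-3) r'] btw a by simp
    ultimately show ?thesis by simp
  qed
  with g(5) s show ?thesis by blast
qed

lemma scaled_dist_less_pi:
  assumes "\<kappa> > 0" "x \<in> model_surface \<kappa>" "y \<in> model_surface \<kappa>" "h \<bullet> x > 0" "h \<bullet> y > 0"
  shows "scaled_dist \<kappa> x y < pi"
proof -
  have k: "\<kappa> \<noteq> 0" using assms(1) by simp
  have "scaled_dist \<kappa> x y \<noteq> pi"
  proof
    assume "scaled_dist \<kappa> x y = pi"
    then have "form \<kappa> x y = -1" using form_eq_gcos[OF k assms(2,3)] assms(1) by (simp add: gcos_def)
    then have "form \<kappa> (x + y) (x + y) = 0"
      using form_self[OF k assms(2)] form_self[OF k assms(3)] form_sym[of \<kappa> x y]
      by (simp add: form_linear)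
    then have "x + y = 0" using assms(1) by (simp add: form_inner)
    then have "h \<bullet> x + h \<bullet> y = 0" by (metis inner_add_right inner_zero_right)
    then show False using assms(4,5) by simp
  qed
  then show ?thesis using scaled_dist_bounds(2)[OF k assms(2,3,1)] by simp
qed

text \<open>Were the perimeter a full great circle, the combination \<open>N\<close> of the vertices, with
  nonnegative coefficients, would be null and hence zero; but in an open hemisphere it has a positive
  component along \<open>h\<close>.\<close>
lemma perimeter_ne_2pi:
  assumes "\<kappa> > 0" "u \<in> model_surface \<kappa>" "v \<in> model_surface \<kappa>" "w \<in> model_surface \<kappa>"
    and h: "h \<bullet> u > 0" "h \<bullet> v > 0" "h \<bullet> w > 0"
  shows "scaled_dist \<kappa> v w + scaled_dist \<kappa> w u + scaled_dist \<kappa> u v \<noteq> 2 * pi"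
proof
  have k: "\<kappa> \<noteq> 0" using assms(1) by simp
  define b c where "b = scaled_dist \<kappa> w u" and "c = scaled_dist \<kappa> u v"
  assume "scaled_dist \<kappa> v w + scaled_dist \<kappa> w u + scaled_dist \<kappa> u v = 2 * pi"
  then have a: "scaled_dist \<kappa> v w = 2 * pi - (b + c)" by (simp add: b_def c_def)
  have lt: "scaled_dist \<kappa> v w < pi" "b < pi" "c < pi" "0 \<le> scaled_dist \<kappa> v w" "0 \<le> b" "0 \<le> c"
    using scaled_dist_less_pi[OF assms(1)] scaled_dist_bounds(1)[OF k] assms by (auto simp: b_def c_def)
  then have "0 < b" "0 < c" using a by auto
  \<comment> \<open>As \<open>sin (scaled_dist \<kappa> v w) = - sin (b + c)\<close>, each vertex is weighted by the sine of the opposite side.\<close>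
  define N where "N = (- sin (b + c)) *\<^sub>R u + sin b *\<^sub>R v + sin c *\<^sub>R w"
  have f: "form \<kappa> v w = cos (b + c)" "form \<kappa> w v = cos (b + c)"
      "form \<kappa> u v = cos c" "form \<kappa> v u = cos c" "form \<kappa> w u = cos b" "form \<kappa> u w = cos b"
      "form \<kappa> u u = 1" "form \<kappa> v v = 1" "form \<kappa> w w = 1"
    using form_eq_gcos[OF k assms(3,4)] form_eq_gcos[OF k assms(4,2)]
      form_eq_gcos[OF k assms(2,3)] form_self[OF k] assms(1-4) a
    by (auto simp: b_def c_def form_sym[of \<kappa> v u] form_sym[of \<kappa> w v] form_sym[of \<kappa> u w] gcos_def
        cos_diff)
  have Nu: "form \<kappa> N u = 0" by (simp add: N_def form_linear f sin_add)
  have "form \<kappa> N v = - (sin b * cos c + cos b * sin c) * cos c + sin b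
      + sin c * (cos b * cos c - sin b * sin c)"
    by (simp add: N_def form_linear f sin_add cos_add)
  also have "\<dots> = 0" using sin_cos_squared_add[of c] by algebra
  finally have Nv: "form \<kappa> N v = 0" .
  have "form \<kappa> N w = - (sin b * cos c + cos b * sin c) * cos b
      + sin b * (cos b * cos c - sin b * sin c) + sin c"
    by (simp add: N_def form_linear f sin_add cos_add)
  also have "\<dots> = 0" using sin_cos_squared_add[of b] by algebra
  finally have Nw: "form \<kappa> N w = 0" .
  have "form \<kappa> N N = - sin (b + c) * form \<kappa> N u + sin b * form \<kappa> N v + sin c * form \<kappa> N w"
    by (simp only: N_def form_linear)
  then have "N = 0" using Nu Nv Nw assms(1) by (simp add: form_inner)
  then have "h \<bullet> N = 0" by simp
  then have "- sin (b + c) * (h \<bullet> u) + sin b * (h \<bullet> v) + sin c * (h \<bullet> w) = 0"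
    by (simp add: N_def inner_add_right inner_diff_right)
  moreover have "sin b * (h \<bullet> v) > 0" "sin c * (h \<bullet> w) > 0"
    using sin_gt_zero lt \<open>0 < b\<close> \<open>0 < c\<close> h by auto
  moreover have "- sin (b + c) \<ge> 0"
  proof -
    have "- sin (b + c) = sin (scaled_dist \<kappa> v w)" unfolding a by (simp add: sin_diff)
    then show ?thesis using lt sin_ge_zero[of "scaled_dist \<kappa> v w"] by simp
  qed
  ultimately show False using h(1) by (smt (verit) mult_nonneg_nonneg)
qed

text \<open>The two factors add up to a quantity of known sign, so a nonnegative product fixes the sign of both.\<close>
lemma side_le_sum:
  assumes "0 \<le> a" "0 \<le> b" "0 \<le> c" "\<kappa> > 0 \<Longrightarrow> a \<le> pi \<and> b \<le> pi \<and> c \<le> pi"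
    and "(gcos \<kappa> (b - c) - gcos \<kappa> a) * (gcos \<kappa> a - gcos \<kappa> (b + c)) \<ge> 0"
  shows "a \<le> b + c"
proof (cases "\<kappa> > 0")
  case True
  have "sin b * sin c \<ge> 0" using assms True by (intro mult_nonneg_nonneg sin_ge_zero) auto
  then have "cos (b - c) \<ge> cos (b + c)" by (simp add: cos_add cos_diff)
  then have "cos a \<ge> cos (b + c)" using assms(5) True
    by (auto simp: gcos_def zero_le_mult_iff)
  then show ?thesis using cos_monotone_0_pi[of "b + c" a] assms True by fastforce
next
  case False
  have "sinh b * sinh c \<ge> 0" using assms by (intro mult_nonneg_nonneg) auto
  then have "cosh (b - c) \<le> cosh (b + c)" by (simp add: cosh_add cosh_diff)
  then have "cosh a \<le> cosh (b + c)" using assms(5) False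
    by (auto simp: gcos_def zero_le_mult_iff)
  then show ?thesis using cosh_real_nonneg_le_iff[of a "b + c"] assms by auto
qed

lemma triangle_inequality:
  assumes "\<kappa> \<noteq> 0" "u \<in> model_surface \<kappa>" "v \<in> model_surface \<kappa>" "w \<in> model_surface \<kappa>"
  shows "scaled_dist \<kappa> v w \<le> scaled_dist \<kappa> w u + scaled_dist \<kappa> u v"
    and "det3 u v w \<noteq> 0 \<Longrightarrow> scaled_dist \<kappa> v w < scaled_dist \<kappa> w u + scaled_dist \<kappa> u v"
proof -
  define a b c where "a = scaled_dist \<kappa> v w" and "b = scaled_dist \<kappa> w u" and "c = scaled_dist \<kappa> u v"
  have G: "(gcos \<kappa> (b - c) - gcos \<kappa> a) * (gcos \<kappa> a - gcos \<kappa> (b + c)) = \<bar>\<kappa>\<bar> ^ 3 * (det3 u v w)\<^sup>2"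
    using gram_det3[OF assms(1) form_self form_self form_self] assms form_eq_gcos
    by (simp add: a_def b_def c_def gram_factor[symmetric])
  show 1: "scaled_dist \<kappa> v w \<le> scaled_dist \<kappa> w u + scaled_dist \<kappa> u v"
    using side_le_sum[of a b c \<kappa>] G scaled_dist_bounds[OF assms(1)] assms(2-4)
    by (simp add: a_def b_def c_def)
  assume "det3 u v w \<noteq> 0"
  then have "gcos \<kappa> a \<noteq> gcos \<kappa> (b + c)" using G assms(1) by auto
  then show "scaled_dist \<kappa> v w < scaled_dist \<kappa> w u + scaled_dist \<kappa> u v" using 1
    by (auto simp: a_def b_def c_def less_le)
qed

text \<open>When the Gram determinant vanishes, one of the factors in \<open>gram_factor\<close> does. The last alternative, three
  points around a great circle, is specific to the sphere.\<close>
lemma coplanar_cases: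
  assumes "\<kappa> \<noteq> 0" "u \<in> model_surface \<kappa>" "v \<in> model_surface \<kappa>" "w \<in> model_surface \<kappa>"
    and "det3 u v w = 0"
  defines "a \<equiv> scaled_dist \<kappa> v w" and "b \<equiv> scaled_dist \<kappa> w u" and "c \<equiv> scaled_dist \<kappa> u v"
  shows "a = b + c \<or> b = c + a \<or> c = a + b \<or> (\<kappa> > 0 \<and> a + b + c = 2 * pi)"
proof -
  have "(gcos \<kappa> (b - c) - gcos \<kappa> a) * (gcos \<kappa> a - gcos \<kappa> (b + c)) = \<bar>\<kappa>\<bar> ^ 3 * (det3 u v w)\<^sup>2"
    using gram_det3[OF assms(1) form_self form_self form_self] assms form_eq_gcos
    by (simp add: a_def b_def c_def gram_factor[symmetric])
  then have *: "gcos \<kappa> a = gcos \<kappa> \<bar>b - c\<bar> \<or> gcos \<kappa> a = gcos \<kappa> (b + c)" using assms(5) by (auto simp: gcos_abs)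
  have nn: "0 \<le> a" "0 \<le> b" "0 \<le> c"
    unfolding a_def b_def c_def using scaled_dist_bounds(1)[OF assms(1)] assms(2-4) by simp_all
  have le: "\<kappa> > 0 \<Longrightarrow> a \<le> pi" "\<kappa> > 0 \<Longrightarrow> b \<le> pi" "\<kappa> > 0 \<Longrightarrow> c \<le> pi"
    unfolding a_def b_def c_def using scaled_dist_bounds(2)[OF assms(1)] assms(2-4) by simp_all
  from * show ?thesis
  proof
    assume "gcos \<kappa> a = gcos \<kappa> \<bar>b - c\<bar>"
    then have "a = \<bar>b - c\<bar>" using nn le by - (rule gcos_inj[where \<kappa> = \<kappa>], auto)
    then show ?thesis by auto
  next
    assume e: "gcos \<kappa> a = gcos \<kappa> (b + c)"
    show ?thesis
    proof (cases "\<kappa> > 0 \<and> b + c > pi")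
      case True
      then have "gcos \<kappa> a = gcos \<kappa> (2 * pi - (b + c))" using e by (simp add: gcos_def cos_diff)
      then have "a = 2 * pi - (b + c)" using nn le True by - (rule gcos_inj[where \<kappa> = \<kappa>], auto)
      then show ?thesis using True by simp
    next
      case False
      then have "a = b + c" using nn le e by - (rule gcos_inj[where \<kappa> = \<kappa>], auto)
      then show ?thesis by simp
    qed
  qed
qed

section \<open>The parallel side compared with half the side\<close>

text \<open>For a triangle with sides \<open>2 x\<close>, \<open>2 y\<close>, \<open>2 z\<close> and parallel side \<open>w\<close> of \<open>2 x\<close>: the defect of
  \<open>w = x\<close> is the Gram determinant of the half sides.\<close>
lemma parallel_side_gram:
  assumes "4 * gcos \<kappa> y * gcos \<kappa> z * gcos \<kappa> w = 1 + gcos \<kappa> (2 * y) + gcos \<kappa> (2 * z) + gcos \<kappa> (2 * x)"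
  shows "2 * (gcos \<kappa> y * gcos \<kappa> z) * (gcos \<kappa> x - gcos \<kappa> w)
      = (gcos \<kappa> (y - z) - gcos \<kappa> x) * (gcos \<kappa> x - gcos \<kappa> (y + z))"
  using assms unfolding gram_factor[symmetric] gcos_double by algebra

lemma half_gram_nonneg:
  assumes "0 \<le> x" "0 \<le> y" "0 \<le> z" "\<kappa> > 0 \<Longrightarrow> x < pi / 2 \<and> y < pi / 2 \<and> z < pi / 2"
    and "x \<le> y + z" "y \<le> z + x" "z \<le> x + y"
  shows "(gcos \<kappa> (y - z) - gcos \<kappa> x) * (gcos \<kappa> x - gcos \<kappa> (y + z)) \<ge> 0"
    and "x < y + z \<Longrightarrow> y < z + x \<Longrightarrow> z < x + y \<Longrightarrow>
      (gcos \<kappa> (y - z) - gcos \<kappa> x) * (gcos \<kappa> x - gcos \<kappa> (y + z)) > 0"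
proof -
  have d: "gcos \<kappa> (y - z) = gcos \<kappa> \<bar>y - z\<bar>" by (simp add: gcos_abs)
  show "(gcos \<kappa> (y - z) - gcos \<kappa> x) * (gcos \<kappa> x - gcos \<kappa> (y + z)) \<ge> 0"
  proof (cases "\<kappa> > 0")
    case True
    then show ?thesis unfolding d using assms
      by (intro mult_nonneg_nonneg) (auto simp: gcos_def simp del: cos_abs_real intro!: cos_monotone_0_pi_le)
  next
    case False
    then show ?thesis unfolding d using assms
      by (intro mult_nonpos_nonpos)
        (auto simp: gcos_def cosh_real_nonneg_le_iff simp del: cosh_real_abs)
  qed
  assume "x < y + z" "y < z + x" "z < x + y"
  then show "(gcos \<kappa> (y - z) - gcos \<kappa> x) * (gcos \<kappa> x - gcos \<kappa> (y + z)) > 0"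
  proof (cases "\<kappa> > 0")
    case True
    with \<open>x < y + z\<close> \<open>y < z + x\<close> \<open>z < x + y\<close> show ?thesis unfolding d using assms
      by (intro mult_pos_pos) (auto simp: gcos_def simp del: cos_abs_real intro!: cos_monotone_0_pi)
  next
    case False
    with \<open>x < y + z\<close> \<open>y < z + x\<close> \<open>z < x + y\<close> show ?thesis unfolding d using assms
      by (intro mult_neg_neg)
        (auto simp: gcos_def cosh_real_nonneg_less_iff simp del: cosh_real_abs)
  qed
qed

lemma parallel_side_vs_half:
  assumes "0 \<le> x" "0 \<le> y" "0 \<le> z" "0 \<le> w"
    and "\<kappa> > 0 \<Longrightarrow> x < pi / 2 \<and> y < pi / 2 \<and> z < pi / 2 \<and> w \<le> pi"
    and tri: "x \<le> y + z" "y \<le> z + x" "z \<le> x + y"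
    and eq: "4 * gcos \<kappa> y * gcos \<kappa> z * gcos \<kappa> w = 1 + gcos \<kappa> (2 * y) + gcos \<kappa> (2 * z) + gcos \<kappa> (2 * x)"
  shows "\<kappa> < 0 \<Longrightarrow> w \<le> x" "\<kappa> > 0 \<Longrightarrow> x \<le> w"
    and "x < y + z \<Longrightarrow> y < z + x \<Longrightarrow> z < x + y \<Longrightarrow> w \<noteq> x"
proof -
  have pos: "gcos \<kappa> y * gcos \<kappa> z > 0"
    using assms cos_gt_zero_pi[of y] cos_gt_zero_pi[of z]
    by (cases "\<kappa> > 0") (auto simp: gcos_def cosh_real_pos intro!: mult_pos_pos)
  have G: "2 * (gcos \<kappa> y * gcos \<kappa> z) * (gcos \<kappa> x - gcos \<kappa> w)
      = (gcos \<kappa> (y - z) - gcos \<kappa> x) * (gcos \<kappa> x - gcos \<kappa> (y + z))"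
    by (rule parallel_side_gram[OF eq])
  have "(gcos \<kappa> (y - z) - gcos \<kappa> x) * (gcos \<kappa> x - gcos \<kappa> (y + z)) \<ge> 0"
    by (rule half_gram_nonneg) (use assms in auto)
  then have "0 \<le> 2 * (gcos \<kappa> y * gcos \<kappa> z) * (gcos \<kappa> x - gcos \<kappa> w)" unfolding G .
  then have le: "gcos \<kappa> w \<le> gcos \<kappa> x" using pos by (simp only: zero_le_mult_iff) linarith
  show "\<kappa> < 0 \<Longrightarrow> w \<le> x" using le assms by (simp add: gcos_def cosh_real_nonneg_le_iff)
  show "\<kappa> > 0 \<Longrightarrow> x \<le> w" using le assms cos_monotone_0_pi[of w x]
    by (fastforce simp: gcos_def)
  assume "x < y + z" "y < z + x" "z < x + y"
  then have "(gcos \<kappa> (y - z) - gcos \<kappa> x) * (gcos \<kappa> x - gcos \<kappa> (y + z)) > 0"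
    by (intro half_gram_nonneg) (use assms in auto)
  then show "w \<noteq> x" using G by auto
qed

lemma le_sinh:
  fixes t :: real
  assumes "0 \<le> t"
  shows "t \<le> sinh t"
proof -
  have "\<exists>y. ((\<lambda>s. sinh s - s) has_real_derivative y) (at s) \<and> 0 \<le> y" for s :: real
    by (rule exI[of _ "cosh s - 1"]) (auto intro!: derivative_eq_intros cosh_real_ge_1)
  then have "sinh 0 - 0 \<le> sinh t - t"
    using assms by (intro DERIV_nonneg_imp_nondecreasing[of 0 t "\<lambda>s. sinh s - s"]) auto
  then show ?thesis by simp
qed

lemma sinh_le_mult_cosh:
  fixes t :: real
  assumes "0 \<le> t"
  shows "sinh t \<le> t * cosh t"
proof -
  have "\<exists>y. ((\<lambda>s. s * cosh s - sinh s) has_real_derivative y) (at s) \<and> 0 \<le> y"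
    if "0 \<le> s" for s :: real
    by (rule exI[of _ "s * sinh s"]) (use that in \<open>auto intro!: derivative_eq_intros\<close>)
  then have "0 * cosh 0 - sinh 0 \<le> t * cosh t - sinh t"
    using assms
    by (intro DERIV_nonneg_imp_nondecreasing[of 0 t "\<lambda>s. s * cosh s - sinh s"]) auto
  then show ?thesis by simp
qed

lemma cosh_le_exp: "0 \<le> t \<Longrightarrow> cosh t \<le> exp t" for t :: real
  using cosh_plus_sinh[of t] sinh_real_nonneg_iff[of t] by linarith

text \<open>The midpoint formula reads \<open>4 cosh y cosh z (sinh (w/2))\<^sup>2 = (sinh x)\<^sup>2 + (cosh y - cosh z)\<^sup>2\<close>. Dropping
  the last square bounds \<open>sinh (w/2)\<close> from below by a multiple of \<open>sinh x\<close>.\<close>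
lemma hyperbolic_parallel_side_ge:
  assumes "0 \<le> x" "0 \<le> y" "0 \<le> z" "0 \<le> w" "w \<le> x"
    and eq: "4 * cosh y * cosh z * cosh w = 1 + cosh (2 * y) + cosh (2 * z) + cosh (2 * x :: real)"
  shows "x * exp (- (x + y + z)) \<le> w"
proof -
  define P where "P = cosh y * cosh z"
  have P: "P \<ge> 1" unfolding P_def using cosh_real_ge_1[of y] cosh_real_ge_1[of z]
    using mult_mono[of 1 "cosh y" 1 "cosh z"] by simp
  have "2 * P * (cosh w - 1) = (sinh x)\<^sup>2 + (cosh y - cosh z)\<^sup>2"
    using eq cosh_double_cosh[of x] cosh_double_cosh[of y] cosh_double_cosh[of z]
      hyperbolic_pythagoras[of x] unfolding P_def by algebra
  then have "(sinh x)\<^sup>2 \<le> 2 * P * (cosh w - 1)" by simp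
  also have "cosh w - 1 = 2 * (sinh (w / 2))\<^sup>2"
    using cosh_double_cosh[of "w / 2"] hyperbolic_pythagoras[of "w / 2"] by simp
  also have "2 * P * (2 * (sinh (w / 2))\<^sup>2) \<le> P * P * (2 * sinh (w / 2))\<^sup>2"
    using P mult_right_mono[of 1 P "(sinh (w / 2))\<^sup>2"]
    by (simp add: power_mult_distrib)
  finally have "(sinh x)\<^sup>2 \<le> (P * (2 * sinh (w / 2)))\<^sup>2"
    by (simp add: power2_eq_square mult_ac)
  then have "sinh x \<le> P * (2 * sinh (w / 2))"
    by (rule power2_le_imp_le) (use P assms in auto)
  also have "P * (2 * sinh (w / 2)) \<le> P * (w * cosh (w / 2))"
    using sinh_le_mult_cosh[of "w / 2"] P assms(4) by (intro mult_left_mono) auto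
  finally have "x \<le> P * (w * cosh (w / 2))"
    using le_sinh[OF assms(1)] by linarith
  also have "\<dots> = w * (cosh y * cosh z * cosh (w / 2))" by (simp add: P_def)
  also have "\<dots> \<le> w * (exp y * exp z * exp x)"
    using assms cosh_le_exp[of y] cosh_le_exp[of z] cosh_le_exp[of "w / 2"]
      order_trans[OF cosh_le_exp[of "w / 2"], of "exp x"]
    by (intro mult_left_mono mult_mono) (auto intro: less_imp_le cosh_real_pos)
  also have "\<dots> = w * exp (x + y + z)" by (simp add: exp_add mult_ac)
  finally have "x * exp (- (x + y + z)) \<le> w * exp (x + y + z) * exp (- (x + y + z))"
    by (intro mult_right_mono) auto
  moreover have "exp (x + y + z) * exp (- (x + y + z)) = 1" by (simp flip: exp_add)
  ultimately show ?thesis by (simp only: mult.assoc mult_1_right)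
qed

lemma mult_cos_le_sin:
  fixes t :: real
  assumes "0 \<le> t" "t \<le> pi / 2"
  shows "t * cos t \<le> sin t"
proof -
  have "\<exists>y. ((\<lambda>s. sin s - s * cos s) has_real_derivative y) (at s) \<and> 0 \<le> y"
    if "0 \<le> s" "s \<le> t" for s :: real
    by (rule exI[of _ "s * sin s"])
      (use that assms in \<open>auto intro!: derivative_eq_intros mult_nonneg_nonneg sin_ge_zero\<close>)
  then have "sin 0 - 0 * cos 0 \<le> sin t - t * cos t"
    using assms
    by (intro DERIV_nonneg_imp_nondecreasing[of 0 t "\<lambda>s. sin s - s * cos s"]) auto
  then show ?thesis by simp
qed

text \<open>The midpoint formula reads \<open>4 cos y cos z (sin (w/2))\<^sup>2 = (sin x)\<^sup>2 - (cos y - cos z)\<^sup>2\<close>; dropping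
  the last square bounds \<open>sin (w/2)\<close> from above by a multiple of \<open>sin x\<close>.\<close>
lemma spherical_parallel_side_le:
  fixes x y z w q :: real
  assumes "0 \<le> x" "x \<le> pi / 2" "0 \<le> w" "w \<le> pi"
    and q: "0 < q" "q \<le> cos y" "q \<le> cos z" "q \<le> cos (w / 2)"
    and eq: "4 * cos y * cos z * cos w = 1 + cos (2 * y) + cos (2 * z) + cos (2 * x)"
  shows "w * q\<^sup>2 \<le> x"
proof -
  define P where "P = cos y * cos z"
  have "2 * P * (1 - cos w) = (sin x)\<^sup>2 - (cos y - cos z)\<^sup>2"
    using eq cos_double_cos[of x] cos_double_cos[of y] cos_double_cos[of z]
      sin_cos_squared_add[of x] unfolding P_def by algebra
  moreover have "1 - cos w = 2 * (sin (w / 2))\<^sup>2"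
    using cos_double_sin[of "w / 2"] by simp
  ultimately have "P * (2 * sin (w / 2))\<^sup>2 = (sin x)\<^sup>2 - (cos y - cos z)\<^sup>2"
    by (simp add: power_mult_distrib)
  then have "P * (2 * sin (w / 2))\<^sup>2 \<le> (sin x)\<^sup>2"
    using zero_le_power2[of "cos y - cos z"] by linarith
  moreover have "q\<^sup>2 \<le> P"
    unfolding P_def power2_eq_square using q by (intro mult_mono) auto
  ultimately have "(q * (2 * sin (w / 2)))\<^sup>2 \<le> (sin x)\<^sup>2"
    using mult_right_mono[of "q\<^sup>2" P "(2 * sin (w / 2))\<^sup>2"] by (simp add: power_mult_distrib)
  then have "q * (2 * sin (w / 2)) \<le> sin x"
    by (rule power2_le_imp_le) (use assms in \<open>auto intro!: sin_ge_zero\<close>)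
  also have "\<dots> \<le> x" using assms by (intro sin_x_le_x)
  finally have 1: "q * (2 * sin (w / 2)) \<le> x" .
  have "w * q \<le> w * cos (w / 2)" using q assms by (intro mult_left_mono) auto
  also have "\<dots> \<le> 2 * sin (w / 2)" using mult_cos_le_sin[of "w / 2"] assms by simp
  finally have "q * (w * q) \<le> q * (2 * sin (w / 2))" using q by (intro mult_left_mono) auto
  with 1 show ?thesis by (simp add: power2_eq_square mult_ac)
qed

section \<open>The gnomonic chart of a hemisphere\<close>

text \<open>Central projection to the plane \<open>h \<bullet> x = 1\<close>, which maps great circles to straight lines.\<close>
definition chart :: "real^3 \<Rightarrow> real^3 \<Rightarrow> real^3" where
  "chart h u = (1 / (h \<bullet> u)) *\<^sub>R u"

text \<open>Geodesic midpoints are multiples of \<open>u + v\<close>, so their charts are weighted means, with weights proportional to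
  the heights of \<open>u\<close> and \<open>v\<close> over the boundary of the hemisphere.\<close>
lemma chart_sum:
  assumes "c *\<^sub>R m = u + v" "0 < h \<bullet> u" "0 < h \<bullet> v"
  shows "chart h m = chart h u + (h \<bullet> v / (h \<bullet> u + h \<bullet> v)) *\<^sub>R (chart h v - chart h u)"
proof -
  have s: "c * (h \<bullet> m) = h \<bullet> u + h \<bullet> v"
    by (metis assms(1) inner_add_right inner_scaleR_right)
  then have c: "c \<noteq> 0" "h \<bullet> m \<noteq> 0" using assms by auto
  have "chart h m = (1 / (c * (h \<bullet> m))) *\<^sub>R (c *\<^sub>R m)" using c by (simp add: chart_def)
  also have "\<dots> = (1 / (h \<bullet> u + h \<bullet> v)) *\<^sub>R (u + v)" by (simp add: s assms(1))
  also have "\<dots> = chart h u + (h \<bullet> v / (h \<bullet> u + h \<bullet> v)) *\<^sub>R (chart h v - chart h u)"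
    using assms(2,3)
    by (simp add: chart_def vec_eq_iff divide_simps) (simp add: algebra_simps)
  finally show ?thesis .
qed

lemma chart_weight_le:
  fixes p q \<eta> :: real
  assumes "0 < \<eta>" "\<eta> \<le> p" "\<eta> \<le> q" "q \<le> 1"
  shows "q / (p + q) \<le> 1 - \<eta> / (1 + \<eta>)"
proof -
  have "\<eta> * q \<le> p" using assms mult_left_mono[of q 1 \<eta>] by linarith
  then show ?thesis using assms by (auto simp: field_simps)
qed

text \<open>Two points on two sides issuing from a common vertex are joined by a combination, with coefficients
  summing to at most \<open>\<mu>\<close>, of the third side and one of the two sides.\<close>
lemma norm_subdivision_le:
  fixes A B C :: "'a::real_normed_vector"
  assumes "norm (A - B) \<le> D" "norm (A - C) \<le> D" "norm (B - C) \<le> D"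
    and "0 \<le> s" "s \<le> \<mu>" "0 \<le> t" "t \<le> \<mu>"
  shows "norm ((A + s *\<^sub>R (B - A)) - (A + t *\<^sub>R (C - A))) \<le> \<mu> * D"
proof -
  have D: "0 \<le> D" using assms(1) norm_ge_zero order_trans by blast
  have *: "norm ((A + s *\<^sub>R (B - A)) - (A + t *\<^sub>R (C - A))) \<le> \<mu> * D"
    if "norm (A - B) \<le> D" "norm (B - C) \<le> D" "0 \<le> t" "t \<le> s" "s \<le> \<mu>" for s t :: real and B C
  proof -
    have "(A + s *\<^sub>R (B - A)) - (A + t *\<^sub>R (C - A)) = t *\<^sub>R (B - C) - (s - t) *\<^sub>R (A - B)"
      by (simp add: algebra_simps)
    also have "norm \<dots> \<le> t * norm (B - C) + (s - t) * norm (A - B)"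
      using that by (intro order_trans[OF norm_triangle_ineq4]) simp
    also have "\<dots> \<le> t * D + (s - t) * D"
      using that by (intro add_mono mult_left_mono) auto
    also have "\<dots> \<le> \<mu> * D" using that D mult_right_mono[of s \<mu> D] by (simp add: algebra_simps)
    finally show ?thesis .
  qed
  show ?thesis
  proof (cases "t \<le> s")
    case True
    then show ?thesis using *[of B C t s] assms by simp
  next
    case False
    then show ?thesis using *[of C B s t] assms
      by (metis norm_minus_commute linear)
  qed
qed

text \<open>Radial projection onto a ball from its outside does not increase distances; chart points lie outside
  the sphere as \<open>h \<bullet> u \<le> 1\<close>.\<close>
lemma norm_diff_le_chart:
  assumes "norm u = norm v" "0 < h \<bullet> u" "h \<bullet> u \<le> 1" "0 < h \<bullet> v" "h \<bullet> v \<le> 1"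
  shows "norm (u - v) \<le> norm (chart h u - chart h v)"
proof (rule power2_le_imp_le)
  define \<alpha> \<beta> r where "\<alpha> = 1 / (h \<bullet> u)" and "\<beta> = 1 / (h \<bullet> v)" and "r = u \<bullet> u"
  have ab: "\<alpha> \<ge> 1" "\<beta> \<ge> 1" using assms by (auto simp: \<alpha>_def \<beta>_def)
  then have "\<alpha> * \<beta> \<ge> 1" using mult_mono[of 1 \<alpha> 1 \<beta>] by simp
  have r: "v \<bullet> v = r" using assms(1) by (metis dot_square_norm r_def)
  have "u \<bullet> v \<le> r" using norm_cauchy_schwarz[of u v] assms(1)
    by (simp add: r_def dot_square_norm power2_eq_square)
  have "(norm (chart h u - chart h v))\<^sup>2 - (norm (u - v))\<^sup>2
      = (\<alpha> - \<beta>)\<^sup>2 * r + 2 * (\<alpha> * \<beta> - 1) * (r - u \<bullet> v)"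
    unfolding chart_def \<alpha>_def[symmetric] \<beta>_def[symmetric]
    by (simp only: power2_norm_eq_inner)
      (simp add: inner_diff_left inner_diff_right inner_commute[of v u] r
        r_def[symmetric] algebra_simps power2_eq_square)
  also have "\<dots> \<ge> 0" using \<open>\<alpha> * \<beta> \<ge> 1\<close> \<open>u \<bullet> v \<le> r\<close>
    by (intro add_nonneg_nonneg mult_nonneg_nonneg) (auto simp: r_def)
  finally show "(norm (u - v))\<^sup>2 \<le> (norm (chart h u - chart h v))\<^sup>2" by simp
qed simp

lemma chart_diff_le:
  assumes "0 < \<eta>" "\<eta> \<le> h \<bullet> u" "\<eta> \<le> h \<bullet> v" "h \<bullet> v \<le> 1" "norm h * norm v \<le> 1"
  shows "norm (chart h u - chart h v) \<le> 2 * norm (u - v) / \<eta>\<^sup>2"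
proof -
  have p: "0 < h \<bullet> u" "0 < h \<bullet> v" using assms by auto
  have "\<bar>h \<bullet> (v - u)\<bar> * norm v \<le> (norm h * norm (v - u)) * norm v"
    by (intro mult_right_mono Cauchy_Schwarz_ineq2) auto
  also have "\<dots> \<le> norm (u - v)"
    using mult_right_mono[OF assms(5), of "norm (v - u)"] by (simp add: norm_minus_commute mult_ac)
  finally have 1: "norm ((h \<bullet> (v - u)) *\<^sub>R v) \<le> norm (u - v)" by simp
  have 2: "norm ((h \<bullet> v) *\<^sub>R (u - v)) \<le> norm (u - v)"
    using p assms(4) by (simp add: mult_left_le_one_le)
  have "chart h u - chart h v
      = (1 / ((h \<bullet> u) * (h \<bullet> v))) *\<^sub>R ((h \<bullet> v) *\<^sub>R (u - v) + (h \<bullet> (v - u)) *\<^sub>R v)"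
    using p by (simp add: chart_def vec_eq_iff divide_simps inner_diff_right)
      (simp add: algebra_simps)
  then have "norm (chart h u - chart h v)
      = norm ((h \<bullet> v) *\<^sub>R (u - v) + (h \<bullet> (v - u)) *\<^sub>R v) / ((h \<bullet> u) * (h \<bullet> v))"
    using p by simp
  also have "\<dots> \<le> (2 * norm (u - v)) / (\<eta> * \<eta>)"
    using norm_triangle_ineq[of "(h \<bullet> v) *\<^sub>R (u - v)" "(h \<bullet> (v - u)) *\<^sub>R v"] 1 2 assms p
    by (intro frac_le mult_mono mult_pos_pos) auto
  finally show ?thesis by (simp add: power2_eq_square)
qed

lemma
  assumes "\<kappa> > 0" "u \<in> model_surface \<kappa>" "v \<in> model_surface \<kappa>"
  shows sphere_chord: "sqrt \<kappa> * norm (u - v) = 2 * sin (scaled_dist \<kappa> u v / 2)"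
    and sphere_sum: "sqrt \<kappa> * norm (u + v) = 2 * cos (scaled_dist \<kappa> u v / 2)"
proof -
  have k: "\<kappa> \<noteq> 0" using assms(1) by simp
  define \<theta> where "\<theta> = scaled_dist \<kappa> u v"
  have th: "0 \<le> \<theta>" "\<theta> \<le> pi" using scaled_dist_bounds[OF k assms(2,3)] assms(1) by (auto simp: \<theta>_def)
  have f: "\<kappa> * (u \<bullet> u) = 1" "\<kappa> * (v \<bullet> v) = 1" "\<kappa> * (u \<bullet> v) = cos \<theta>"
    using form_self[OF k] form_eq_gcos[OF k assms(2,3)] assms
    by (auto simp: form_inner gcos_def \<theta>_def)
  have "(sqrt \<kappa> * norm (u - v))\<^sup>2 = \<kappa> * (u \<bullet> u) + \<kappa> * (v \<bullet> v) - 2 * (\<kappa> * (u \<bullet> v))"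
    using assms(1) by (simp add: power_mult_distrib power2_norm_eq_inner inner_diff_left
        inner_diff_right inner_commute[of v u] algebra_simps)
  also have "\<dots> = (2 * sin (\<theta> / 2))\<^sup>2"
    unfolding f using cos_double_sin[of "\<theta> / 2"] by (simp add: power_mult_distrib)
  finally show "sqrt \<kappa> * norm (u - v) = 2 * sin (scaled_dist \<kappa> u v / 2)"
    unfolding \<theta>_def[symmetric]
    by (rule power2_eq_imp_eq) (use th assms(1) in \<open>auto intro!: sin_ge_zero\<close>)
  have "(sqrt \<kappa> * norm (u + v))\<^sup>2 = \<kappa> * (u \<bullet> u) + \<kappa> * (v \<bullet> v) + 2 * (\<kappa> * (u \<bullet> v))"
    using assms(1) by (simp add: power_mult_distrib power2_norm_eq_inner inner_add_left
        inner_add_right inner_commute[of v u] algebra_simps)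
  also have "\<dots> = (2 * cos (\<theta> / 2))\<^sup>2"
    unfolding f using cos_double_cos[of "\<theta> / 2"] by (simp add: power_mult_distrib)
  finally show "sqrt \<kappa> * norm (u + v) = 2 * cos (scaled_dist \<kappa> u v / 2)"
    unfolding \<theta>_def[symmetric]
    by (rule power2_eq_imp_eq) (use th assms(1) in \<open>auto intro!: cos_ge_zero\<close>)
qed

text \<open>The cosine of half a side is at least \<open>\<eta>\<close>, as \<open>u + v\<close> has a component at least \<open>2 \<eta>\<close> along \<open>h\<close>, and it is close
  to \<open>1\<close> when the side is short. The single exponential bound combines both and is suited to products.\<close>
lemma exp_le_cos_half:
  assumes "\<kappa> > 0" "u \<in> model_surface \<kappa>" "v \<in> model_surface \<kappa>"
    and h: "norm h = sqrt \<kappa>" and \<eta>: "0 < \<eta>" "\<eta> \<le> h \<bullet> u" "\<eta> \<le> h \<bullet> v" "h \<bullet> u \<le> 1" "h \<bullet> v \<le> 1"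
    and E: "sqrt \<kappa> * norm (chart h u - chart h v) \<le> E"
  shows "exp (- (E / (2 * \<eta>))) \<le> cos (scaled_dist \<kappa> u v / 2)"
proof -
  define c s where "c = cos (scaled_dist \<kappa> u v / 2)" and "s = sin (scaled_dist \<kappa> u v / 2)"
  have th: "0 \<le> scaled_dist \<kappa> u v" "scaled_dist \<kappa> u v \<le> pi" using scaled_dist_bounds[of \<kappa> u v] assms by auto
  have "2 * \<eta> \<le> h \<bullet> (u + v)" using \<eta> by (simp add: inner_add_right)
  also have "\<dots> \<le> sqrt \<kappa> * norm (u + v)" using norm_cauchy_schwarz[of h "u + v"] h by simp
  finally have c: "\<eta> \<le> c" using sphere_sum[OF assms(1-3)] by (simp add: c_def)
  have "0 \<le> s" unfolding s_def using th by (intro sin_ge_zero) auto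
  have "norm u = norm v" using assms(2,3,1) by (simp add: model_surface_def)
  then have "sqrt \<kappa> * norm (u - v) \<le> sqrt \<kappa> * norm (chart h u - chart h v)"
    using assms by (intro mult_left_mono norm_diff_le_chart) auto
  then have "2 * s \<le> E" using sphere_chord[OF assms(1-3)] E by (simp add: s_def)
  have "1 - c \<le> 1 - c\<^sup>2" using c \<eta>(1) by (simp add: c_def power2_eq_square mult_left_le)
  also have "\<dots> = s * s" using sin_cos_squared_add[of "scaled_dist \<kappa> u v / 2"]
    by (simp add: c_def s_def power2_eq_square algebra_simps)
  also have "\<dots> \<le> s" using \<open>0 \<le> s\<close> by (simp add: s_def mult_left_le)
  finally have "1 - c \<le> E / 2" using \<open>2 * s \<le> E\<close> by simp
  then have "(1 - c) / c \<le> (E / 2) / \<eta>" using c \<eta>(1) \<open>0 \<le> s\<close> \<open>2 * s \<le> E\<close> by (intro frac_le) auto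
  have "1 / c = 1 + (1 - c) / c" using c \<eta>(1) by (simp add: field_simps)
  also have "\<dots> \<le> exp ((1 - c) / c)" by (rule exp_ge_add_one_self)
  also have "\<dots> \<le> exp (E / (2 * \<eta>))" using \<open>(1 - c) / c \<le> (E / 2) / \<eta>\<close> by simp
  finally show ?thesis using c \<eta>(1) by (simp add: exp_minus c_def field_simps)
qed

section \<open>Triangles and their medial pieces\<close>

definition scaled_side :: "real \<Rightarrow> triangle \<Rightarrow> label \<Rightarrow> real" where
  "scaled_side \<kappa> t x = sqrt \<bar>\<kappa>\<bar> * side_length \<kappa> t x"

definition scaled_perimeter :: "real \<Rightarrow> triangle \<Rightarrow> real" where
  "scaled_perimeter \<kappa> t = scaled_side \<kappa> t LA + scaled_side \<kappa> t LB + scaled_side \<kappa> t LC"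

definition vertex_det :: "triangle \<Rightarrow> real" where
  "vertex_det t = det3 (vert t LA) (vert t LB) (vert t LC)"

definition midvertex :: "real \<Rightarrow> real^3 \<Rightarrow> real^3 \<Rightarrow> real^3 \<Rightarrow> bool" where
  "midvertex \<kappa> p q m \<longleftrightarrow> m \<in> model_surface \<kappa> \<and> scaled_dist \<kappa> p m = scaled_dist \<kappa> p q / 2 \<and>
     scaled_dist \<kappa> q m = scaled_dist \<kappa> p q / 2 \<and> (2 * gcos \<kappa> (scaled_dist \<kappa> p q / 2)) *\<^sub>R m = p + q"

lemma ex_other_labels: obtains y z where "distinct [x, y, z :: label]"
  by (cases x) (auto intro: that[of LA LB] that[of LB LC] that[of LC LA])

lemma ex_third_label: 
  assumes "y \<noteq> z" obtains x :: label where "distinct [x, y, z]"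
  using assms by (cases y; cases z) (auto intro: that[of LA] that[of LB] that[of LC])

lemma distinct_labels_cover: "distinct [x, y, z :: label] \<Longrightarrow> w = x \<or> w = y \<or> w = z"
  by (cases x; cases y; cases z; cases w) auto

lemma scaled_side_eq: "distinct [x, y, z] \<Longrightarrow> scaled_side \<kappa> t x = scaled_dist \<kappa> (vert t y) (vert t z)"
  by (cases x; cases y; cases z)
    (auto simp: scaled_side_def side_length_def scaled_dist_def model_dist_sym)

lemma scaled_perimeter_eq:
  "distinct [x, y, z] \<Longrightarrow> scaled_perimeter \<kappa> t = scaled_side \<kappa> t x + scaled_side \<kappa> t y + scaled_side \<kappa> t z"
  by (cases x; cases y; cases z) (auto simp: scaled_perimeter_def)

lemma vertex_det_eq_0_iff:
  "distinct [x, y, z] \<Longrightarrow> vertex_det t = 0 \<longleftrightarrow> det3 (vert t x) (vert t y) (vert t z) = 0"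
  by (cases x; cases y; cases z) (auto simp: vertex_det_def det3_def algebra_simps)

lemma vert_in_surface: "geodesic_triangle \<kappa> t \<Longrightarrow> vert t x \<in> model_surface \<kappa>"
  by (simp add: geodesic_triangle_def)

lemma scaled_side_bounds:
  assumes "\<kappa> \<noteq> 0" "geodesic_triangle \<kappa> t"
  shows "0 \<le> scaled_side \<kappa> t x" "\<kappa> > 0 \<Longrightarrow> scaled_side \<kappa> t x < pi"
proof -
  obtain y z where d: "distinct [x, y, z]" by (rule ex_other_labels)
  show "0 \<le> scaled_side \<kappa> t x" unfolding scaled_side_eq[OF d]
    using assms by (intro scaled_dist_bounds vert_in_surface)
  assume k: "\<kappa> > 0"
  then obtain h where "\<forall>x. h \<bullet> vert t x > 0" using assms(2) by (auto simp: geodesic_triangle_def)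
  then show "scaled_side \<kappa> t x < pi" unfolding scaled_side_eq[OF d]
    using assms(2) k by (intro scaled_dist_less_pi[of \<kappa> _ _ h] vert_in_surface) auto
qed

lemma scaled_side_le_perimeter:
  assumes "\<kappa> \<noteq> 0" "geodesic_triangle \<kappa> t"
  shows "scaled_side \<kappa> t x \<le> scaled_perimeter \<kappa> t"
  using scaled_side_bounds(1)[OF assms, of LA] scaled_side_bounds(1)[OF assms, of LB]
    scaled_side_bounds(1)[OF assms, of LC]
  by (cases x) (auto simp: scaled_perimeter_def)

lemma scaled_side_triangle_inequality:
  assumes "\<kappa> \<noteq> 0" "geodesic_triangle \<kappa> t" "distinct [x, y, z]"
  shows "scaled_side \<kappa> t x \<le> scaled_side \<kappa> t y + scaled_side \<kappa> t z"
    and "vertex_det t \<noteq> 0 \<Longrightarrow> scaled_side \<kappa> t x < scaled_side \<kappa> t y + scaled_side \<kappa> t z"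
proof -
  have d: "distinct [y, z, x]" "distinct [z, x, y]" using assms(3) by auto
  note v = vert_in_surface[OF assms(2)]
  show "scaled_side \<kappa> t x \<le> scaled_side \<kappa> t y + scaled_side \<kappa> t z"
    using triangle_inequality(1)[OF assms(1) v v v, of y z x]
    by (simp add: scaled_side_eq[OF assms(3)] scaled_side_eq[OF d(1)] scaled_side_eq[OF d(2)])
  assume "vertex_det t \<noteq> 0"
  then show "scaled_side \<kappa> t x < scaled_side \<kappa> t y + scaled_side \<kappa> t z"
    using triangle_inequality(2)[OF assms(1) v v v, of x y z] vertex_det_eq_0_iff[OF assms(3), of t]
    by (simp add: scaled_side_eq[OF assms(3)] scaled_side_eq[OF d(1)] scaled_side_eq[OF d(2)])
qed

text \<open>If the vertices are linearly dependent, \<open>coplanar_cases\<close> puts one vertex on the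
  opposite side, or the perimeter is a full great circle, which the hemisphere condition excludes.\<close>
lemma nondegenerate_vertex_det:
  assumes k: "\<kappa> \<noteq> 0" and t: "geodesic_triangle \<kappa> t" and "nondegenerate t"
  shows "vertex_det t \<noteq> 0"
proof
  assume "vertex_det t = 0"
  note v = vert_in_surface[OF t]
  have on_side: "scaled_side \<kappa> t x \<noteq> scaled_side \<kappa> t y + scaled_side \<kappa> t z" if "distinct [x, y, z]" for x y z
  proof
    have d: "distinct [y, z, x]" "distinct [z, x, y]" using that by auto
    assume e: "scaled_side \<kappa> t x = scaled_side \<kappa> t y + scaled_side \<kappa> t z"
    have "vert t x \<in> side t x"
    proof (rule between_in_segment[OF k v v v])
      show "geodesic_segment \<kappa> (vert t y) (vert t z) (side t x)"
        using t that by (simp add: geodesic_triangle_def)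
      show "scaled_dist \<kappa> (vert t y) (vert t z) = scaled_dist \<kappa> (vert t y) (vert t x) + scaled_dist \<kappa> (vert t x) (vert t z)"
        using e by (simp add: scaled_side_eq[OF that] scaled_side_eq[OF d(1)] scaled_side_eq[OF d(2)]
            scaled_dist_sym[of \<kappa> "vert t z" "vert t x"] scaled_dist_sym[of \<kappa> "vert t y" "vert t x"])
      show "scaled_dist \<kappa> (vert t y) (vert t z) < pi" if "\<kappa> > 0"
        using scaled_side_bounds(2)[OF k t that, of x] by (simp add: scaled_side_eq[OF \<open>distinct [x, y, z]\<close>])
    qed
    then show False using assms(3) by (simp add: nondegenerate_def)
  qed
  have e: "scaled_side \<kappa> t LA = scaled_dist \<kappa> (vert t LB) (vert t LC)"
    "scaled_side \<kappa> t LB = scaled_dist \<kappa> (vert t LC) (vert t LA)" "scaled_side \<kappa> t LC = scaled_dist \<kappa> (vert t LA) (vert t LB)"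
    by (rule scaled_side_eq; simp)+
  have "\<kappa> > 0 \<and> scaled_side \<kappa> t LA + scaled_side \<kappa> t LB + scaled_side \<kappa> t LC = 2 * pi"
    using coplanar_cases[OF k v v v, of LA LB LC] \<open>vertex_det t = 0\<close>
      on_side[of LA LB LC] on_side[of LB LC LA] on_side[of LC LA LB]
    by (simp add: e vertex_det_def)
  moreover from this obtain h where "\<forall>x. h \<bullet> vert t x > 0"
    using t by (auto simp: geodesic_triangle_def)
  ultimately show False using perimeter_ne_2pi[of \<kappa> "vert t LA" "vert t LB" "vert t LC" h] v
    by (simp add: e)
qed

lemma medial_piece_vertices:
  assumes "\<kappa> \<noteq> 0" "geodesic_triangle \<kappa> t" "medial_piece \<kappa> t k t'"
  obtains m where
    "\<And>x y z. distinct [x, y, z] \<Longrightarrow> midvertex \<kappa> (vert t y) (vert t z) (m x)"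
    "\<And>x. k = Inner \<Longrightarrow> vert t' x = m x"
    "\<And>x. k = Outer x \<Longrightarrow> vert t' x = vert t x"
    "\<And>x y z. k = Outer x \<Longrightarrow> distinct [x, y, z] \<Longrightarrow> vert t' y = m z"
proof -
  obtain m where m: "\<forall>x y z. distinct [x, y, z] \<longrightarrow>
           midpoint_of_segment \<kappa> (vert t y) (vert t z) (side t x) (m x)"
    and p: "case k of
           Inner \<Rightarrow> (\<forall>x. vert t' x = m x)
         | Outer x \<Rightarrow>
             vert t' x = vert t x \<and>
             (\<forall>y z. distinct [x, y, z] \<longrightarrow> vert t' y = m z \<and> side t' y \<subseteq> side t y)"
    using assms(3) unfolding medial_piece_def by blast
  show thesis
  proof (rule that[of m])
    show "midvertex \<kappa> (vert t y) (vert t z) (m x)" if "distinct [x, y, z]" for x y z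
    proof -
      have "geodesic_segment \<kappa> (vert t y) (vert t z) (side t x)"
        using assms(2) that unfolding geodesic_triangle_def by blast
      then show ?thesis unfolding midvertex_def
        using midpoint_vector[OF assms(1)] vert_in_surface[OF assms(2)] m that by meson
    qed
  qed (use p in auto)
qed

text \<open>Side \<open>x\<close> of a medial piece either joins the midpoints of the two old sides at \<open>vert t x\<close>, or is half of
  the old side \<open>x\<close>.\<close>
lemma medial_side_cases:
  assumes "\<kappa> \<noteq> 0" "geodesic_triangle \<kappa> t" "medial_piece \<kappa> t k t'" "distinct [x, y, z]"
  shows "(\<exists>p q. {p, q} = {vert t' y, vert t' z} \<and>
      midvertex \<kappa> (vert t x) (vert t y) p \<and> midvertex \<kappa> (vert t x) (vert t z) q) \<or>
    k \<noteq> Inner \<and> k \<noteq> Outer x \<and>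
      (vert t' y = vert t y \<and> midvertex \<kappa> (vert t y) (vert t z) (vert t' z) \<or>
       vert t' z = vert t z \<and> midvertex \<kappa> (vert t z) (vert t y) (vert t' y))"
proof -
  obtain m where m: "\<And>x y z. distinct [x, y, z] \<Longrightarrow> midvertex \<kappa> (vert t y) (vert t z) (m x)"
    and i: "\<And>x. k = Inner \<Longrightarrow> vert t' x = m x"
    and o: "\<And>x. k = Outer x \<Longrightarrow> vert t' x = vert t x"
    and o': "\<And>x y z. k = Outer x \<Longrightarrow> distinct [x, y, z] \<Longrightarrow> vert t' y = m z"
    using medial_piece_vertices[OF assms(1-3)] by metis
  have mm: "midvertex \<kappa> (vert t x) (vert t y) (m z)" "midvertex \<kappa> (vert t x) (vert t z) (m y)"
    "midvertex \<kappa> (vert t y) (vert t z) (m x)" "midvertex \<kappa> (vert t z) (vert t y) (m x)"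
    by (rule m; use assms(4) in auto)+
  show ?thesis
  proof (cases k)
    case Inner
    then have "{m z, m y} = {vert t' y, vert t' z}" using i by auto
    then show ?thesis using mm by blast
  next
    case (Outer w)
    from distinct_labels_cover[OF assms(4), of w] show ?thesis
    proof (elim disjE)
      assume "w = x"
      then have "vert t' y = m z" "vert t' z = m y" using o'[of x] Outer assms(4) by auto
      then have "{m z, m y} = {vert t' y, vert t' z}" by auto
      then show ?thesis using mm by blast
    next
      assume "w = y"
      then have "vert t' y = vert t y" "vert t' z = m x" using o[of y] o'[of y z x] Outer assms(4) by auto
      then show ?thesis using mm Outer \<open>w = y\<close> assms(4) by auto
    next
      assume "w = z"
      then have "vert t' z = vert t z" "vert t' y = m x" using o[of z] o'[of z y x] Outer assms(4) by auto
      then show ?thesis using mm Outer \<open>w = z\<close> assms(4) by auto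
    qed
  qed
qed

text \<open>The equation is in terms of half sides because that is how \<open>parallel_side_vs_half\<close>, \<open>hyperbolic_parallel_side_ge\<close>
  and \<open>spherical_parallel_side_le\<close> use it.\<close>
lemma medial_scaled_side_cases:
  assumes "\<kappa> \<noteq> 0" "geodesic_triangle \<kappa> t" "medial_piece \<kappa> t k t'" "distinct [x, y, z]"
  shows "4 * gcos \<kappa> (scaled_side \<kappa> t y / 2) * gcos \<kappa> (scaled_side \<kappa> t z / 2) * gcos \<kappa> (scaled_side \<kappa> t' x)
      = 1 + gcos \<kappa> (2 * (scaled_side \<kappa> t y / 2)) + gcos \<kappa> (2 * (scaled_side \<kappa> t z / 2)) + gcos \<kappa> (2 * (scaled_side \<kappa> t x / 2)) \<or>
    k \<noteq> Inner \<and> k \<noteq> Outer x \<and> scaled_side \<kappa> t' x = scaled_side \<kappa> t x / 2"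
proof -
  have d: "distinct [y, z, x]" "distinct [z, x, y]" using assms(4) by auto
  note e = scaled_side_eq[OF assms(4)] scaled_side_eq[OF d(1)] scaled_side_eq[OF d(2)]
  note v = vert_in_surface[OF assms(2)]
  from medial_side_cases[OF assms] show ?thesis
  proof
    assume "\<exists>p q. {p, q} = {vert t' y, vert t' z} \<and>
      midvertex \<kappa> (vert t x) (vert t y) p \<and> midvertex \<kappa> (vert t x) (vert t z) q"
    then obtain p q where pq: "{p, q} = {vert t' y, vert t' z}"
      "midvertex \<kappa> (vert t x) (vert t y) p" "midvertex \<kappa> (vert t x) (vert t z) q" by blast
    then have "4 * gcos \<kappa> (scaled_dist \<kappa> (vert t x) (vert t y) / 2) * gcos \<kappa> (scaled_dist \<kappa> (vert t x) (vert t z) / 2)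
        * gcos \<kappa> (scaled_dist \<kappa> p q)
      = 1 + gcos \<kappa> (scaled_dist \<kappa> (vert t x) (vert t y)) + gcos \<kappa> (scaled_dist \<kappa> (vert t x) (vert t z))
        + gcos \<kappa> (scaled_dist \<kappa> (vert t y) (vert t z))"
      by (intro parallel_side_gcos[OF assms(1) v v v]) (auto simp: midvertex_def)
    moreover have "scaled_dist \<kappa> p q = scaled_dist \<kappa> (vert t' y) (vert t' z)"
      using pq(1) by (auto simp: doubleton_eq_iff scaled_dist_sym)
    ultimately show ?thesis
      by (simp add: e scaled_dist_sym[of \<kappa> "vert t z" "vert t x"] mult_ac)
  next
    assume "k \<noteq> Inner \<and> k \<noteq> Outer x \<and>
      (vert t' y = vert t y \<and> midvertex \<kappa> (vert t y) (vert t z) (vert t' z) \<or>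
       vert t' z = vert t z \<and> midvertex \<kappa> (vert t z) (vert t y) (vert t' y))"
    then show ?thesis
      by (auto simp: e midvertex_def scaled_dist_sym[of \<kappa> "vert t z" "vert t y"]
          scaled_dist_sym[of \<kappa> "vert t' y" "vert t z"])
  qed
qed

lemma medial_scaled_side:
  assumes k: "\<kappa> \<noteq> 0" and t: "geodesic_triangle \<kappa> t" and p: "medial_piece \<kappa> t k t'"
  shows "\<kappa> < 0 \<Longrightarrow> scaled_side \<kappa> t' x \<le> scaled_side \<kappa> t x / 2"
    and "\<kappa> < 0 \<Longrightarrow> scaled_side \<kappa> t x / 2 * exp (- scaled_perimeter \<kappa> t) \<le> scaled_side \<kappa> t' x"
    and "\<kappa> > 0 \<Longrightarrow> scaled_side \<kappa> t x / 2 \<le> scaled_side \<kappa> t' x"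
    and "vertex_det t \<noteq> 0 \<Longrightarrow> k = Inner \<or> k = Outer x \<Longrightarrow> scaled_side \<kappa> t' x \<noteq> scaled_side \<kappa> t x / 2"
proof -
  have t': "geodesic_triangle \<kappa> t'" using p by (simp add: medial_piece_def)
  obtain y z where d: "distinct [x, y, z]" by (rule ex_other_labels)
  then have d': "distinct [y, z, x]" "distinct [z, x, y]" by auto
  define a b c w where "a = scaled_side \<kappa> t x / 2" and "b = scaled_side \<kappa> t y / 2" and "c = scaled_side \<kappa> t z / 2"
    and "w = scaled_side \<kappa> t' x"
  have nn: "0 \<le> a" "0 \<le> b" "0 \<le> c" "0 \<le> w"
    using scaled_side_bounds(1)[OF k t] scaled_side_bounds(1)[OF k t'] by (auto simp: a_def b_def c_def w_def)
  have lt: "\<kappa> > 0 \<Longrightarrow> a < pi / 2 \<and> b < pi / 2 \<and> c < pi / 2 \<and> w \<le> pi"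
    using scaled_side_bounds(2)[OF k t, of x] scaled_side_bounds(2)[OF k t, of y] scaled_side_bounds(2)[OF k t, of z]
      scaled_side_bounds(2)[OF k t', of x]
    by (simp add: a_def b_def c_def w_def)
  have tri: "a \<le> b + c" "b \<le> c + a" "c \<le> a + b"
    using scaled_side_triangle_inequality(1)[OF k t d] scaled_side_triangle_inequality(1)[OF k t d'(1)]
      scaled_side_triangle_inequality(1)[OF k t d'(2)]
    by (auto simp: a_def b_def c_def)
  have S: "scaled_perimeter \<kappa> t = 2 * (a + b + c)" by (simp add: scaled_perimeter_eq[OF d] a_def b_def c_def)
  have cases: "4 * gcos \<kappa> b * gcos \<kappa> c * gcos \<kappa> w = 1 + gcos \<kappa> (2 * b) + gcos \<kappa> (2 * c) + gcos \<kappa> (2 * a) \<or>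
      k \<noteq> Inner \<and> k \<noteq> Outer x \<and> w = a"
    using medial_scaled_side_cases[OF k t p d] by (simp only: a_def b_def c_def w_def)
  have le: "w \<le> a" if "\<kappa> < 0"
    using cases parallel_side_vs_half(1)[OF nn lt tri _ that] by auto
  then show "\<kappa> < 0 \<Longrightarrow> scaled_side \<kappa> t' x \<le> scaled_side \<kappa> t x / 2" by (simp add: a_def w_def)
  show "\<kappa> > 0 \<Longrightarrow> scaled_side \<kappa> t x / 2 \<le> scaled_side \<kappa> t' x"
    using cases parallel_side_vs_half(2)[OF nn lt tri] by (auto simp: a_def w_def)
  have "a * exp (- scaled_perimeter \<kappa> t) \<le> w" if "\<kappa> < 0"
  proof -
    have "a * exp (- scaled_perimeter \<kappa> t) \<le> a * exp (- (a + b + c))"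
      using nn S by (intro mult_left_mono) auto
    also have "\<dots> \<le> w"
    proof (cases "w = a")
      case True
      then show ?thesis using nn by (simp add: mult_left_le)
    next
      case False
      then have "4 * cosh b * cosh c * cosh w = 1 + cosh (2 * b) + cosh (2 * c) + cosh (2 * a)"
        using cases that by (simp add: gcos_def)
      then show ?thesis by (intro hyperbolic_parallel_side_ge nn le that)
    qed
    finally show ?thesis .
  qed
  then show "\<kappa> < 0 \<Longrightarrow> scaled_side \<kappa> t x / 2 * exp (- scaled_perimeter \<kappa> t) \<le> scaled_side \<kappa> t' x"
    by (simp add: a_def w_def)
  show "scaled_side \<kappa> t' x \<noteq> scaled_side \<kappa> t x / 2" if "vertex_det t \<noteq> 0" "k = Inner \<or> k = Outer x"
  proof -
    have "a < b + c" "b < c + a" "c < a + b"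
      using scaled_side_triangle_inequality(2)[OF k t d that(1)]
        scaled_side_triangle_inequality(2)[OF k t d'(1) that(1)]
        scaled_side_triangle_inequality(2)[OF k t d'(2) that(1)]
      by (auto simp: a_def b_def c_def)
    then have "w \<noteq> a"
      using cases parallel_side_vs_half(3)[OF nn lt tri] that(2) by blast
    then show ?thesis by (simp add: a_def w_def)
  qed
qed

text \<open>Up to nonzero scalars the new vertices arise from the old ones by a matrix of determinant \<open>2\<close> for the
  innermost piece and \<open>1\<close> for an outer one.\<close>
lemma medial_vertex_det:
  assumes k: "\<kappa> \<noteq> 0" and t: "geodesic_triangle \<kappa> t" and p: "medial_piece \<kappa> t k t'"
    and "vertex_det t \<noteq> 0"
  shows "vertex_det t' \<noteq> 0"
proof -
  have scale: "det3 (a *\<^sub>R u) (b *\<^sub>R v) (c *\<^sub>R w) = a * b * c * det3 u v w" for a b c u v w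
    by (simp add: det3_def algebra_simps)
  obtain m where m: "\<And>x y z. distinct [x, y, z] \<Longrightarrow> midvertex \<kappa> (vert t y) (vert t z) (m x)"
    and i: "\<And>x. k = Inner \<Longrightarrow> vert t' x = m x"
    and o: "\<And>x. k = Outer x \<Longrightarrow> vert t' x = vert t x"
    and o': "\<And>x y z. k = Outer x \<Longrightarrow> distinct [x, y, z] \<Longrightarrow> vert t' y = m z"
    using medial_piece_vertices[OF k t p] by metis
  have m': "\<exists>r. r *\<^sub>R m x = vert t y + vert t z" if "distinct [x, y, z]" for x y z
    using m[OF that] by (auto simp: midvertex_def)
  show ?thesis
  proof (cases k)
    case Inner
    obtain p q r where "p *\<^sub>R m LA = vert t LB + vert t LC" "q *\<^sub>R m LB = vert t LC + vert t LA"
      "r *\<^sub>R m LC = vert t LA + vert t LB"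
      using m'[of LA LB LC] m'[of LB LC LA] m'[of LC LA LB] by auto
    then have "p * q * r * vertex_det t'
        = det3 (vert t LB + vert t LC) (vert t LC + vert t LA) (vert t LA + vert t LB)"
      using scale[of p "m LA" q "m LB" r "m LC"] i Inner by (simp add: vertex_det_def)
    also have "\<dots> = 2 * vertex_det t" by (simp add: vertex_det_def det3_def algebra_simps)
    finally show ?thesis using assms(4) by auto
  next
    case (Outer x)
    obtain y z where d: "distinct [x, y, z]" by (rule ex_other_labels)
    then obtain q r where "q *\<^sub>R m z = vert t x + vert t y" "r *\<^sub>R m y = vert t x + vert t z"
      using m'[of z x y] m'[of y x z] by auto
    moreover have "vert t' x = vert t x" "vert t' y = m z" "vert t' z = m y"
      using o o' Outer d by auto
    ultimately have "1 * q * r * det3 (vert t' x) (vert t' y) (vert t' z)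
        = det3 (vert t x) (vert t x + vert t y) (vert t x + vert t z)"
      using scale[of 1 "vert t x" q "m z" r "m y"] by simp
    also have "\<dots> = det3 (vert t x) (vert t y) (vert t z)" by (simp add: det3_def algebra_simps)
    finally show ?thesis using assms(4) d by (auto simp: vertex_det_eq_0_iff)
  qed
qed

section \<open>Decay of the chart diameter on the sphere\<close>

text \<open>The vertices lie in the cap \<open>h \<bullet> x \<ge> \<eta>\<close>, and their charts have diameter at most \<open>D\<close> in units of the
  curvature radius. For \<open>norm h = sqrt \<kappa>\<close> the heights \<open>h \<bullet> x\<close> are at most \<open>1\<close>.\<close>
definition chart_bounded :: "real \<Rightarrow> real^3 \<Rightarrow> real \<Rightarrow> real \<Rightarrow> triangle \<Rightarrow> bool" where
  "chart_bounded \<kappa> h \<eta> D t \<longleftrightarrow> (\<forall>x. \<eta> \<le> h \<bullet> vert t x) \<and>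
     (\<forall>x y. sqrt \<kappa> * norm (chart h (vert t x) - chart h (vert t y)) \<le> D)"

lemma inner_le_1:
  assumes "\<kappa> > 0" "v \<in> model_surface \<kappa>" "norm h = sqrt \<kappa>"
  shows "h \<bullet> v \<le> 1" "norm h * norm v \<le> 1"
proof -
  show 1: "norm h * norm v \<le> 1" using assms by (simp add: model_surface_def)
  show "h \<bullet> v \<le> 1" using norm_cauchy_schwarz[of h v] 1 by linarith
qed

text \<open>The cap is geodesically convex, and the weight of either endpoint in \<open>chart_sum\<close> is at least
  \<open>\<eta> / (1 + \<eta>)\<close> as both heights lie between \<open>\<eta>\<close> and \<open>1\<close>.\<close>
lemma midvertex_chart:
  assumes k: "\<kappa> > 0" and h: "norm h = sqrt \<kappa>" and \<eta>: "0 < \<eta>" "\<eta> \<le> h \<bullet> p" "\<eta> \<le> h \<bullet> q"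
    and p: "p \<in> model_surface \<kappa>" and q: "q \<in> model_surface \<kappa>" and m: "midvertex \<kappa> p q m"
  shows "\<eta> \<le> h \<bullet> m"
    and "\<exists>s. 0 \<le> s \<and> s \<le> 1 - \<eta> / (1 + \<eta>) \<and>
      chart h m = chart h p + s *\<^sub>R (chart h q - chart h p)"
proof -
  define c where "c = 2 * gcos \<kappa> (scaled_dist \<kappa> p q / 2)"
  have c: "c *\<^sub>R m = p + q" "c \<le> 2" using m k by (auto simp: midvertex_def c_def gcos_def)
  have "scaled_dist \<kappa> p q \<ge> 0" "scaled_dist \<kappa> p q \<le> pi" using scaled_dist_bounds[of \<kappa> p q] k p q by auto
  then have "0 \<le> c" using k by (auto simp: c_def gcos_def intro!: cos_ge_zero)
  have s: "c * (h \<bullet> m) = h \<bullet> p + h \<bullet> q"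
    by (metis c(1) inner_add_right inner_scaleR_right)
  then have "0 < c * (h \<bullet> m)" using \<eta> by simp
  then have "0 < h \<bullet> m" using \<open>0 \<le> c\<close> by (simp add: zero_less_mult_iff)
  then have "c * (h \<bullet> m) \<le> 2 * (h \<bullet> m)" using c(2) by (intro mult_right_mono) auto
  then show "\<eta> \<le> h \<bullet> m" using s \<eta> by simp
  show "\<exists>s. 0 \<le> s \<and> s \<le> 1 - \<eta> / (1 + \<eta>) \<and>
      chart h m = chart h p + s *\<^sub>R (chart h q - chart h p)"
    using chart_sum[OF c(1), of h] \<eta> inner_le_1(1)[OF k p h] inner_le_1(1)[OF k q h]
      chart_weight_le[OF \<eta>(1), of "h \<bullet> p" "h \<bullet> q"]
    by (intro exI[of _ "h \<bullet> q / (h \<bullet> p + h \<bullet> q)"]) auto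
qed

text \<open>The factor is uniform along a nested sequence because the cap is preserved.\<close>
lemma chart_bounded_medial:
  assumes k: "\<kappa> > 0" and t: "geodesic_triangle \<kappa> t" and p: "medial_piece \<kappa> t k t'"
    and h: "norm h = sqrt \<kappa>" and \<eta>: "0 < \<eta>" and b: "chart_bounded \<kappa> h \<eta> D t"
  shows "chart_bounded \<kappa> h \<eta> ((1 - \<eta> / (1 + \<eta>)) * D) t'"
proof -
  have k0: "\<kappa> \<noteq> 0" using k by simp
  note v = vert_in_surface[OF t]
  define \<mu> where "\<mu> = 1 - \<eta> / (1 + \<eta>)"
  have \<mu>: "0 \<le> \<mu>" using \<eta> by (simp add: \<mu>_def)
  have b1: "\<eta> \<le> h \<bullet> vert t x" for x using b by (simp add: chart_bounded_def)
  have b2: "norm (chart h (vert t x) - chart h (vert t y)) \<le> D / sqrt \<kappa>" for x y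
    using b k by (simp add: chart_bounded_def field_simps)
  have D: "0 \<le> D" using b2[of LA LA] k by (simp add: field_simps)
  have mid: "\<exists>s. 0 \<le> s \<and> s \<le> \<mu> \<and>
      chart h m = chart h (vert t x) + s *\<^sub>R (chart h (vert t y) - chart h (vert t x))"
    if "midvertex \<kappa> (vert t x) (vert t y) m" for x y m
    unfolding \<mu>_def by (rule midvertex_chart(2)[OF k h \<eta> b1 b1 v v that])
  have "\<eta> \<le> h \<bullet> vert t' y" for y
  proof -
    obtain x z where d: "distinct [y, x, z]" by (rule ex_other_labels)
    then have "distinct [x, y, z]" by auto
    have *: "\<eta> \<le> h \<bullet> m" if "midvertex \<kappa> (vert t u) (vert t w) m" for u w m
      by (rule midvertex_chart(1)[OF k h \<eta> b1 b1 v v that])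
    from medial_side_cases[OF k0 t p \<open>distinct [x, y, z]\<close>] show ?thesis
      using * b1 by (auto simp: doubleton_eq_iff)
  qed
  moreover have "sqrt \<kappa> * norm (chart h (vert t' y) - chart h (vert t' z)) \<le> \<mu> * D" for y z
  proof (cases "y = z")
    case True
    then show ?thesis using \<mu> D by simp
  next
    case False
    then obtain x where d: "distinct [x, y, z]" by (rule ex_third_label)
    have *: "norm (chart h P - chart h Q) \<le> \<mu> * (D / sqrt \<kappa>)"
      if P: "midvertex \<kappa> (vert t u) (vert t v) P"
        and Q: "0 \<le> r" "r \<le> \<mu>" "chart h Q = chart h (vert t u) + r *\<^sub>R (chart h (vert t w) - chart h (vert t u))"
      for P Q u v w r
    proof -
      obtain s where "0 \<le> s" "s \<le> \<mu>"
        "chart h P = chart h (vert t u) + s *\<^sub>R (chart h (vert t v) - chart h (vert t u))"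
        using mid[OF P] by blast
      then show ?thesis using Q b2 by (simp only:) (rule norm_subdivision_le)
    qed
    from medial_side_cases[OF k0 t p d]
    have "norm (chart h (vert t' y) - chart h (vert t' z)) \<le> \<mu> * (D / sqrt \<kappa>)"
    proof (elim disjE conjE)
      assume "\<exists>P Q. {P, Q} = {vert t' y, vert t' z} \<and>
        midvertex \<kappa> (vert t x) (vert t y) P \<and> midvertex \<kappa> (vert t x) (vert t z) Q"
      then obtain P Q where PQ: "{P, Q} = {vert t' y, vert t' z}"
        "midvertex \<kappa> (vert t x) (vert t y) P" "midvertex \<kappa> (vert t x) (vert t z) Q" by blast
      obtain r where "0 \<le> r" "r \<le> \<mu>"
        "chart h Q = chart h (vert t x) + r *\<^sub>R (chart h (vert t z) - chart h (vert t x))"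
        using mid[OF PQ(3)] by blast
      then have "norm (chart h P - chart h Q) \<le> \<mu> * (D / sqrt \<kappa>)" using *[OF PQ(2)] by blast
      then show ?thesis using PQ(1) by (auto simp: doubleton_eq_iff norm_minus_commute)
    next
      assume "vert t' y = vert t y" "midvertex \<kappa> (vert t y) (vert t z) (vert t' z)"
      then show ?thesis using *[of y z "vert t' z" 0 "vert t' y" y] \<mu> by (simp add: norm_minus_commute)
    next
      assume "vert t' z = vert t z" "midvertex \<kappa> (vert t z) (vert t y) (vert t' y)"
      then show ?thesis using *[of z y "vert t' y" 0 "vert t' z" z] \<mu> by simp
    qed
    then show ?thesis using k by (simp add: field_simps)
  qed
  ultimately show ?thesis by (simp add: chart_bounded_def \<mu>_def)
qed

text \<open>The chart diameter bounds both the old and the new triangle, so the three cosines in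
  \<open>spherical_parallel_side_le\<close> share the bound \<open>exp_le_cos_half\<close>.\<close>
lemma spherical_medial_scaled_side_le:
  assumes k: "\<kappa> > 0" and t: "geodesic_triangle \<kappa> t" and p: "medial_piece \<kappa> t k t'"
    and h: "norm h = sqrt \<kappa>" and \<eta>: "0 < \<eta>" and b: "chart_bounded \<kappa> h \<eta> D t"
  shows "2 * scaled_side \<kappa> t' x \<le> scaled_side \<kappa> t x * exp (D / \<eta>)"
proof -
  have k0: "\<kappa> \<noteq> 0" using k by simp
  have t': "geodesic_triangle \<kappa> t'" using p by (simp add: medial_piece_def)
  have b': "chart_bounded \<kappa> h \<eta> ((1 - \<eta> / (1 + \<eta>)) * D) t'"
    by (rule chart_bounded_medial[OF assms])
  have "sqrt \<kappa> * norm (chart h (vert t LA) - chart h (vert t LA)) \<le> D"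
    using b unfolding chart_bounded_def by blast
  then have D: "0 \<le> D" by simp
  then have "(1 - \<eta> / (1 + \<eta>)) * D \<le> D" using \<eta> by (simp add: mult_left_le_one_le)
  then have b': "chart_bounded \<kappa> h \<eta> D t'"
    using b' unfolding chart_bounded_def by (meson order_trans)
  define q where "q = exp (- (D / (2 * \<eta>)))"
  have q: "q \<le> cos (scaled_side \<kappa> s y / 2)" if "geodesic_triangle \<kappa> s" "chart_bounded \<kappa> h \<eta> D s" for s y
  proof -
    obtain z w where d: "distinct [y, z, w]" by (rule ex_other_labels)
    note v = vert_in_surface[OF that(1)]
    show ?thesis unfolding q_def scaled_side_eq[OF d]
      using that(2) by (intro exp_le_cos_half[OF k v v h \<eta>] inner_le_1(1)[OF k v h])
        (auto simp: chart_bounded_def)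
  qed
  obtain y z where d: "distinct [x, y, z]" by (rule ex_other_labels)
  have nn: "0 \<le> scaled_side \<kappa> t x" "scaled_side \<kappa> t x < pi" "0 \<le> scaled_side \<kappa> t' x" "scaled_side \<kappa> t' x < pi"
    using scaled_side_bounds[OF k0 t, of x] scaled_side_bounds[OF k0 t', of x] k by auto
  have q2: "q\<^sup>2 * exp (D / \<eta>) = 1"
    by (simp add: q_def power2_eq_square flip: exp_add)
  from medial_scaled_side_cases[OF k0 t p d] have "scaled_side \<kappa> t' x * q\<^sup>2 \<le> scaled_side \<kappa> t x / 2"
  proof
    assume "4 * gcos \<kappa> (scaled_side \<kappa> t y / 2) * gcos \<kappa> (scaled_side \<kappa> t z / 2) * gcos \<kappa> (scaled_side \<kappa> t' x)
      = 1 + gcos \<kappa> (2 * (scaled_side \<kappa> t y / 2)) + gcos \<kappa> (2 * (scaled_side \<kappa> t z / 2))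
        + gcos \<kappa> (2 * (scaled_side \<kappa> t x / 2))"
    then have "4 * cos (scaled_side \<kappa> t y / 2) * cos (scaled_side \<kappa> t z / 2) * cos (scaled_side \<kappa> t' x)
      = 1 + cos (2 * (scaled_side \<kappa> t y / 2)) + cos (2 * (scaled_side \<kappa> t z / 2))
        + cos (2 * (scaled_side \<kappa> t x / 2))" using k by (simp only: gcos_def if_True)
    then show ?thesis
      by (rule spherical_parallel_side_le[rotated -1])
        (use nn q[OF t b] q[OF t' b'] in \<open>auto simp: q_def\<close>)
  next
    assume "k \<noteq> Inner \<and> k \<noteq> Outer x \<and> scaled_side \<kappa> t' x = scaled_side \<kappa> t x / 2"
    moreover have "q\<^sup>2 \<le> 1" using D \<eta> by (simp add: q_def power_le_one)
    ultimately show ?thesis using nn mult_left_le[of "q\<^sup>2" "scaled_side \<kappa> t' x"] by linarith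
  qed
  then have "scaled_side \<kappa> t' x * q\<^sup>2 * exp (D / \<eta>) \<le> scaled_side \<kappa> t x / 2 * exp (D / \<eta>)"
    by (intro mult_right_mono) auto
  then show ?thesis using q2 by (simp only: mult.assoc)
qed

section \<open>Nested sequences of triangles\<close>

lemma nested_geodesic: "nested_triangles \<kappa> t \<Longrightarrow> geodesic_triangle \<kappa> (t n)"
  by (simp add: nested_triangles_def)

text \<open>With \<open>\<rho>\<close> the contraction defect of the chart diameter \<open>D\<close>, the factor \<open>exp (D n / \<eta>)\<close> lost in a step is
  the ratio of consecutive values of the potential \<open>exp (D n / (\<eta> * \<rho>))\<close>. So the product of \<open>2 ^ n\<close>, the side, and the
  potential never grows.\<close>
lemma nested_spherical_upper:
  assumes k: "\<kappa> > 0" and t: "nested_triangles \<kappa> t"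
    and h: "norm h = sqrt \<kappa>" and \<eta>: "0 < \<eta>" "\<And>x. \<eta> \<le> h \<bullet> vert (t 0) x"
  shows "2 ^ n * scaled_side \<kappa> (t n) x
    \<le> scaled_side \<kappa> (t 0) x * exp (2 * (1 + \<eta>) / \<eta> ^ 4 * scaled_perimeter \<kappa> (t 0))"
proof -
  have k0: "\<kappa> \<noteq> 0" using k by simp
  note t0 = nested_geodesic[OF t, of 0]
  define \<rho> where "\<rho> = \<eta> / (1 + \<eta>)"
  have \<rho>: "0 < \<rho>" "\<rho> < 1" using \<eta>(1) by (auto simp: \<rho>_def)
  define D where "D n = (1 - \<rho>) ^ n * (2 * scaled_perimeter \<kappa> (t 0) / \<eta>\<^sup>2)" for n
  have S: "0 \<le> scaled_perimeter \<kappa> (t 0)"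
    using scaled_side_bounds(1)[OF k0 t0] by (simp add: scaled_perimeter_def)
  have D0: "0 \<le> D n" for n using \<rho> S by (simp add: D_def)
  have bd: "chart_bounded \<kappa> h \<eta> (D n) (t n)" for n
  proof (induction n)
    case 0
    have "sqrt \<kappa> * norm (chart h (vert (t 0) x) - chart h (vert (t 0) y)) \<le> D 0" for x y
    proof (cases "x = y")
      case True
      then show ?thesis using D0 by simp
    next
      case False
      then obtain z where d: "distinct [z, x, y]" by (rule ex_third_label)
      note v = vert_in_surface[OF t0]
      let ?u = "vert (t 0) x" and ?v = "vert (t 0) y"
      have "norm (chart h ?u - chart h ?v) \<le> 2 * norm (?u - ?v) / \<eta>\<^sup>2"
        by (rule chart_diff_le[OF \<eta> \<eta>(2) inner_le_1[OF k v h]])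
      then have "sqrt \<kappa> * norm (chart h ?u - chart h ?v) \<le> sqrt \<kappa> * (2 * norm (?u - ?v) / \<eta>\<^sup>2)"
        using k by (intro mult_left_mono) auto
      also have "\<dots> = 2 * (2 * sin (scaled_dist \<kappa> ?u ?v / 2)) / \<eta>\<^sup>2"
        unfolding sphere_chord[OF k v v, symmetric] by simp
      also have "\<dots> \<le> 2 * scaled_dist \<kappa> ?u ?v / \<eta>\<^sup>2"
        using sin_x_le_x[of "scaled_dist \<kappa> ?u ?v / 2"] scaled_dist_bounds(1)[OF k0 v v]
        by (intro divide_right_mono) auto
      also have "\<dots> \<le> D 0"
        using scaled_side_le_perimeter[OF k0 t0, of z] by (simp add: D_def scaled_side_eq[OF d] divide_right_mono)
      finally show ?thesis .
    qed
    then show ?case using \<eta>(2) by (simp add: chart_bounded_def)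
  next
    case (Suc n)
    obtain j where "medial_piece \<kappa> (t n) j (t (Suc n))" using t by (auto simp: nested_triangles_def)
    from chart_bounded_medial[OF k nested_geodesic[OF t] this h \<eta>(1) Suc] show ?case
      by (simp add: D_def \<rho>_def mult_ac)
  qed
  have pot: "2 ^ n * scaled_side \<kappa> (t n) x * exp (D n / (\<eta> * \<rho>)) \<le> scaled_side \<kappa> (t 0) x * exp (D 0 / (\<eta> * \<rho>))" for n
  proof (induction n)
    case 0
    then show ?case by simp
  next
    case (Suc n)
    obtain j where j: "medial_piece \<kappa> (t n) j (t (Suc n))" using t by (auto simp: nested_triangles_def)
    have "D (Suc n) = D n - \<rho> * D n"
      unfolding D_def power_Suc by (simp only: left_diff_distrib mult_1 mult.assoc)
    then have e: "D n / \<eta> + D (Suc n) / (\<eta> * \<rho>) = D n / (\<eta> * \<rho>)"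
      using \<eta>(1) \<rho> by (simp add: field_simps)
    have "2 ^ Suc n * scaled_side \<kappa> (t (Suc n)) x * exp (D (Suc n) / (\<eta> * \<rho>))
        = 2 ^ n * exp (D (Suc n) / (\<eta> * \<rho>)) * (2 * scaled_side \<kappa> (t (Suc n)) x)" by simp
    also have "\<dots> \<le> 2 ^ n * exp (D (Suc n) / (\<eta> * \<rho>)) * (scaled_side \<kappa> (t n) x * exp (D n / \<eta>))"
      by (intro mult_left_mono spherical_medial_scaled_side_le[OF k nested_geodesic[OF t] j h \<eta>(1) bd]) auto
    also have "\<dots> = 2 ^ n * scaled_side \<kappa> (t n) x * exp (D n / \<eta> + D (Suc n) / (\<eta> * \<rho>))"
      by (simp add: exp_add)
    also note e
    also note Suc
    finally show ?case .
  qed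
  have le: "2 ^ n * scaled_side \<kappa> (t n) x * 1 \<le> 2 ^ n * scaled_side \<kappa> (t n) x * exp (D n / (\<eta> * \<rho>))"
    using D0 \<eta>(1) \<rho> scaled_side_bounds(1)[OF k0 nested_geodesic[OF t]] by (intro mult_left_mono) auto
  have e0: "D 0 / (\<eta> * \<rho>) = 2 * (1 + \<eta>) / \<eta> ^ 4 * scaled_perimeter \<kappa> (t 0)"
    using \<eta>(1) by (simp add: D_def \<rho>_def field_simps power2_eq_square eval_nat_numeral)
  show ?thesis using le pot[of n] unfolding e0 mult_1_right by linarith
qed

lemma nested_spherical_lower:
  assumes k: "\<kappa> > 0" and t: "nested_triangles \<kappa> t" and "m \<le> n"
  shows "2 ^ m * scaled_side \<kappa> (t m) x \<le> 2 ^ n * scaled_side \<kappa> (t n) x"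
  using \<open>m \<le> n\<close>
proof (rule lift_Suc_mono_le[where f = "\<lambda>n. 2 ^ n * scaled_side \<kappa> (t n) x", rotated])
  fix n
  obtain j where "medial_piece \<kappa> (t n) j (t (Suc n))" using t by (auto simp: nested_triangles_def)
  from medial_scaled_side(3)[OF _ nested_geodesic[OF t] this k, of x] k
  show "2 ^ n * scaled_side \<kappa> (t n) x \<le> 2 ^ Suc n * scaled_side \<kappa> (t (Suc n)) x" by simp
qed

lemma nested_hyperbolic_upper:
  assumes k: "\<kappa> < 0" and t: "nested_triangles \<kappa> t" and "m \<le> n"
  shows "2 ^ n * scaled_side \<kappa> (t n) x \<le> 2 ^ m * scaled_side \<kappa> (t m) x"
  using \<open>m \<le> n\<close>
proof (rule lift_Suc_antimono_le[where f = "\<lambda>n. 2 ^ n * scaled_side \<kappa> (t n) x", rotated])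
  fix n
  obtain j where "medial_piece \<kappa> (t n) j (t (Suc n))" using t by (auto simp: nested_triangles_def)
  from medial_scaled_side(1)[OF _ nested_geodesic[OF t] this k, of x] k
  show "2 ^ Suc n * scaled_side \<kappa> (t (Suc n)) x \<le> 2 ^ n * scaled_side \<kappa> (t n) x" by simp
qed

text \<open>The exponents lost are bounded by the partial sums of the geometric series \<open>P\<^sub>0 / 2 ^ n\<close> of the perimeters.\<close>
lemma nested_hyperbolic_lower:
  assumes k: "\<kappa> < 0" and t: "nested_triangles \<kappa> t"
  shows "scaled_side \<kappa> (t 0) x * exp (- 2 * scaled_perimeter \<kappa> (t 0)) \<le> 2 ^ n * scaled_side \<kappa> (t n) x"
proof -
  have k0: "\<kappa> \<noteq> 0" using k by simp
  define S where "S = scaled_perimeter \<kappa> (t 0)"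
  have S0: "0 \<le> S" using scaled_side_bounds(1)[OF k0 nested_geodesic[OF t]] by (simp add: S_def scaled_perimeter_def)
  have S: "2 ^ n * scaled_perimeter \<kappa> (t n) \<le> S" for n
    using nested_hyperbolic_upper[OF k t, of 0 n LA] nested_hyperbolic_upper[OF k t, of 0 n LB]
      nested_hyperbolic_upper[OF k t, of 0 n LC]
    by (simp add: scaled_perimeter_def S_def algebra_simps)
  have "scaled_side \<kappa> (t 0) x * exp (- 2 * S * (1 - (1/2) ^ n)) \<le> 2 ^ n * scaled_side \<kappa> (t n) x"
  proof (induction n)
    case 0
    then show ?case by simp
  next
    case (Suc n)
    obtain j where j: "medial_piece \<kappa> (t n) j (t (Suc n))" using t by (auto simp: nested_triangles_def)
    have e: "- 2 * S * (1 - (1/2) ^ Suc n) = - 2 * S * (1 - (1/2) ^ n) + - (S / 2 ^ n)"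
      by (simp add: field_simps power_one_over)
    have "scaled_side \<kappa> (t 0) x * exp (- 2 * S * (1 - (1/2) ^ Suc n))
        = scaled_side \<kappa> (t 0) x * exp (- 2 * S * (1 - (1/2) ^ n)) * exp (- (S / 2 ^ n))"
      unfolding e exp_add by simp
    also have "\<dots> \<le> 2 ^ n * scaled_side \<kappa> (t n) x * exp (- (S / 2 ^ n))"
      by (intro mult_right_mono Suc) auto
    also have "\<dots> \<le> 2 ^ n * scaled_side \<kappa> (t n) x * exp (- scaled_perimeter \<kappa> (t n))"
      using S[of n] scaled_side_bounds(1)[OF k0 nested_geodesic[OF t]]
      by (intro mult_left_mono mult_nonneg_nonneg) (auto simp: field_simps)
    also have "\<dots> = 2 ^ Suc n * (scaled_side \<kappa> (t n) x / 2 * exp (- scaled_perimeter \<kappa> (t n)))" by simp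
    also have "\<dots> \<le> 2 ^ Suc n * scaled_side \<kappa> (t (Suc n)) x"
      by (intro mult_left_mono medial_scaled_side(2)[OF k0 nested_geodesic[OF t] j k]) auto
    finally show ?case .
  qed
  moreover have "scaled_side \<kappa> (t 0) x * exp (- 2 * S) \<le> scaled_side \<kappa> (t 0) x * exp (- 2 * S * (1 - (1/2) ^ n))"
    using S0 scaled_side_bounds(1)[OF k0 nested_geodesic[OF t]]
    by (intro mult_left_mono) (auto simp: algebra_simps)
  ultimately show ?thesis by (simp add: S_def)
qed

lemma nested_vertex_det:
  assumes k: "\<kappa> \<noteq> 0" and t: "nested_triangles \<kappa> t" and "nondegenerate (t 0)"
  shows "vertex_det (t n) \<noteq> 0"
proof (induction n)
  case 0
  show ?case by (rule nondegenerate_vertex_det[OF k nested_geodesic[OF t] assms(3)])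
next
  case (Suc n)
  obtain j where "medial_piece \<kappa> (t n) j (t (Suc n))" using t by (auto simp: nested_triangles_def)
  then show ?case by (rule medial_vertex_det[OF k nested_geodesic[OF t] _ Suc])
qed

lemma nested_parallel_ne:
  assumes k: "\<kappa> \<noteq> 0" and t: "nested_triangles \<kappa> t" and "nondegenerate (t 0)" "parallel_step \<kappa> t x n"
  shows "scaled_side \<kappa> (t (Suc n)) x \<noteq> scaled_side \<kappa> (t n) x / 2"
  using assms(4) medial_scaled_side(4)[OF k nested_geodesic[OF t] _ nested_vertex_det[OF k t assms(3)]]
  unfolding parallel_step_def by blast

text \<open>Add two of the strict triangle inequalities.\<close>
lemma nondegenerate_scaled_side_pos:
  assumes "\<kappa> \<noteq> 0" "geodesic_triangle \<kappa> t" "nondegenerate t"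
  shows "0 < scaled_side \<kappa> t x"
proof -
  obtain y z where d: "distinct [x, y, z]" by (rule ex_other_labels)
  then have "distinct [y, z, x]" "distinct [z, x, y]" by auto
  from scaled_side_triangle_inequality(2)[OF assms(1,2) this(1)] scaled_side_triangle_inequality(2)[OF assms(1,2) this(2)]
  show ?thesis using nondegenerate_vertex_det[OF assms] by simp
qed

text \<open>For a triangle with sides below one curvature radius the hemisphere centred at a vertex has
  margin at least \<open>cos 1 \<ge> 1/2\<close>. Fixing this value is what makes the constants uniform for small triangles.\<close>
lemma ex_hemisphere_margin:
  assumes k: "\<kappa> > 0" and t: "geodesic_triangle \<kappa> t"
  shows "\<exists>\<eta> h. norm h = sqrt \<kappa> \<and> 0 < \<eta> \<and> (\<forall>x. \<eta> \<le> h \<bullet> vert t x) \<and>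
     ((\<forall>x. scaled_side \<kappa> t x < 1) \<longrightarrow> \<eta> = 1 / 2)"
proof (cases "\<forall>x. scaled_side \<kappa> t x < 1")
  case True
  have k0: "\<kappa> \<noteq> 0" using k by simp
  note v = vert_in_surface[OF t]
  define h where "h = \<kappa> *\<^sub>R vert t LA"
  have "norm h = sqrt \<kappa>" using v[of LA] k by (simp add: h_def model_surface_def real_div_sqrt)
  moreover have "1 / 2 \<le> h \<bullet> vert t x" for x
  proof -
    have e: "h \<bullet> vert t x = form \<kappa> (vert t LA) (vert t x)" using k by (simp add: h_def form_inner)
    show ?thesis
    proof (cases "x = LA")
      case True
      have "h \<bullet> vert t x = 1" unfolding e by (simp add: True form_self[OF k0 v])
      then show ?thesis by simp
    next
      case False
      then obtain y where d: "distinct [y, LA, x]" using ex_third_label by metis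
      have "cos (pi / 3) \<le> cos (scaled_dist \<kappa> (vert t LA) (vert t x))"
        using True[rule_format, of y] scaled_side_bounds(1)[OF k0 t, of y] pi_gt3
        by (intro cos_monotone_0_pi_le) (auto simp: scaled_side_eq[OF d])
      then show ?thesis using form_eq_gcos[OF k0 v v, of LA x] k by (simp add: e gcos_def cos_60)
    qed
  qed
  ultimately show ?thesis by (intro exI[of _ "1/2"] exI[of _ h]) auto
next
  case False
  obtain g where g: "\<forall>x. g \<bullet> vert t x > 0" using t k by (auto simp: geodesic_triangle_def)
  then have "g \<noteq> 0" by auto
  define h where "h = (sqrt \<kappa> / norm g) *\<^sub>R g"
  have h: "norm h = sqrt \<kappa>" "\<forall>x. h \<bullet> vert t x > 0" using g \<open>g \<noteq> 0\<close> k by (auto simp: h_def)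
  define \<eta> where "\<eta> = min (h \<bullet> vert t LA) (min (h \<bullet> vert t LB) (h \<bullet> vert t LC))"
  have "0 < \<eta>" using h by (simp add: \<eta>_def)
  moreover have "\<eta> \<le> h \<bullet> vert t x" for x by (cases x) (auto simp: \<eta>_def)
  ultimately show ?thesis using h False by blast
qed

section \<open>The comparison constants\<close>

lemma scaled_side_side_length:
  assumes "\<kappa> \<noteq> 0"
  shows "side_length \<kappa> t x = scaled_side \<kappa> t x / sqrt \<bar>\<kappa>\<bar>"
  using assms by (simp add: scaled_side_def)

text \<open>The constant is explicit; the factor \<open>3\<close> instead of the \<open>2\<close> of \<open>nested_hyperbolic_lower\<close> makes the
  inequality strict.\<close>
lemma hyperbolic_case:
  assumes k: "\<kappa> < 0"
  shows "\<exists>l :: (nat \<Rightarrow> triangle) \<Rightarrow> real.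
          (\<forall>t. nested_triangles \<kappa> t \<longrightarrow>
             l t > 0 \<and>
             (\<forall>n. side_length \<kappa> (t 0) x * l t \<le> 2 ^ n * side_length \<kappa> (t n) x \<and>
                  2 ^ n * side_length \<kappa> (t n) x \<le> side_length \<kappa> (t 0) x) \<and>
             (nondegenerate (t 0) \<and> (\<exists>k. parallel_step \<kappa> t x k) \<longrightarrow>
                l t < 1 \<and>
                (\<forall>n. side_length \<kappa> (t 0) x * l t < 2 ^ n * side_length \<kappa> (t n) x) \<and>
                (\<forall>k n. parallel_step \<kappa> t x k \<and> k < n \<longrightarrow>
                   2 ^ n * side_length \<kappa> (t n) x < side_length \<kappa> (t 0) x))) \<and>
          (\<forall>\<epsilon>>0. \<exists>\<delta>>0. \<forall>t.
             nested_triangles \<kappa> t \<and> (\<exists>k. parallel_step \<kappa> t x k) \<and>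
             (\<forall>y. side_length \<kappa> (t 0) y < \<delta>) \<longrightarrow> \<bar>l t - 1\<bar> < \<epsilon>)"
proof (intro exI[of _ "\<lambda>t. exp (- 3 * scaled_perimeter \<kappa> (t 0))"] conjI allI impI)
  have k0: "\<kappa> \<noteq> 0" using k by simp
  define r where "r = sqrt \<bar>\<kappa>\<bar>"
  have r: "r > 0" using k0 by (simp add: r_def)
  note sl = scaled_side_side_length[OF k0, folded r_def]
  have S0: "0 \<le> scaled_perimeter \<kappa> (t 0)" if "nested_triangles \<kappa> t" for t
    using scaled_side_bounds(1)[OF k0 nested_geodesic[OF that]] by (simp add: scaled_perimeter_def)
  show "exp (- 3 * scaled_perimeter \<kappa> (t 0)) > 0" for t :: "nat \<Rightarrow> triangle" by simp
  fix t assume t: "nested_triangles \<kappa> t"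
  note t0 = nested_geodesic[OF t, of 0]
  show "2 ^ n * side_length \<kappa> (t n) x \<le> side_length \<kappa> (t 0) x" for n
    using nested_hyperbolic_upper[OF k t, of 0 n x] r by (simp add: sl divide_right_mono)
  show "side_length \<kappa> (t 0) x * exp (- 3 * scaled_perimeter \<kappa> (t 0)) \<le> 2 ^ n * side_length \<kappa> (t n) x" for n
  proof -
    have "scaled_side \<kappa> (t 0) x * exp (- 3 * scaled_perimeter \<kappa> (t 0))
        \<le> scaled_side \<kappa> (t 0) x * exp (- 2 * scaled_perimeter \<kappa> (t 0))"
      using S0[OF t] scaled_side_bounds(1)[OF k0 t0] by (intro mult_left_mono) auto
    also note nested_hyperbolic_lower[OF k t, of x n]
    finally show ?thesis using r by (simp add: sl divide_right_mono)
  qed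
  assume nd: "nondegenerate (t 0) \<and> (\<exists>k. parallel_step \<kappa> t x k)"
  note pos = nondegenerate_scaled_side_pos[OF k0 t0 conjunct1[OF nd]]
  have S: "0 < scaled_perimeter \<kappa> (t 0)"
    using pos[of LA] pos[of LB] pos[of LC] by (simp add: scaled_perimeter_def)
  then show "exp (- 3 * scaled_perimeter \<kappa> (t 0)) < 1" by simp
  show "side_length \<kappa> (t 0) x * exp (- 3 * scaled_perimeter \<kappa> (t 0)) < 2 ^ n * side_length \<kappa> (t n) x" for n
  proof -
    have "scaled_side \<kappa> (t 0) x * exp (- 3 * scaled_perimeter \<kappa> (t 0))
        < scaled_side \<kappa> (t 0) x * exp (- 2 * scaled_perimeter \<kappa> (t 0))"
      using S pos by (intro mult_strict_left_mono) auto
    also note nested_hyperbolic_lower[OF k t, of x n]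
    finally show ?thesis using r by (simp add: sl divide_strict_right_mono)
  qed
  fix m n assume mn: "parallel_step \<kappa> t x m \<and> m < n"
  have "scaled_side \<kappa> (t (Suc m)) x \<noteq> scaled_side \<kappa> (t m) x / 2"
    by (rule nested_parallel_ne[OF k0 t]) (use nd mn in auto)
  moreover define f where "f j = 2 ^ j * scaled_side \<kappa> (t j) x" for j
  ultimately have "f (Suc m) \<noteq> f m" by simp
  moreover have "f n \<le> f (Suc m)" "f (Suc m) \<le> f m" "f m \<le> f 0"
    unfolding f_def using mn by (intro nested_hyperbolic_upper[OF k t]; simp)+
  ultimately have "f n < f 0" by linarith
  then have "2 ^ n * scaled_side \<kappa> (t n) x < scaled_side \<kappa> (t 0) x" by (simp add: f_def)
  then show "2 ^ n * side_length \<kappa> (t n) x < side_length \<kappa> (t 0) x"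
    using r by (simp add: sl divide_strict_right_mono)
next
  fix \<epsilon> :: real assume e: "\<epsilon> > 0"
  have k0: "\<kappa> \<noteq> 0" using k by simp
  define r where "r = sqrt \<bar>\<kappa>\<bar>"
  have r: "r > 0" using k0 by (simp add: r_def)
  show "\<exists>\<delta>>0. \<forall>t. nested_triangles \<kappa> t \<and> (\<exists>k. parallel_step \<kappa> t x k) \<and>
      (\<forall>y. side_length \<kappa> (t 0) y < \<delta>) \<longrightarrow> \<bar>exp (- 3 * scaled_perimeter \<kappa> (t 0)) - 1\<bar> < \<epsilon>"
  \<comment> \<open>Three sides, times the factor \<open>3\<close> in the exponent.\<close>
  proof (intro exI[of _ "\<epsilon> / (9 * r)"] conjI allI impI)
    show "\<epsilon> / (9 * r) > 0" using e r by simp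
    fix t assume a: "nested_triangles \<kappa> t \<and> (\<exists>k. parallel_step \<kappa> t x k) \<and>
      (\<forall>y. side_length \<kappa> (t 0) y < \<epsilon> / (9 * r))"
    have "scaled_side \<kappa> (t 0) y < \<epsilon> / 9" for y
      using a r by (simp add: scaled_side_def r_def[symmetric] field_simps)
    from this[of LA] this[of LB] this[of LC] have "3 * scaled_perimeter \<kappa> (t 0) < \<epsilon>"
      by (simp add: scaled_perimeter_def)
    moreover have "0 \<le> scaled_perimeter \<kappa> (t 0)"
      using scaled_side_bounds(1)[OF k0 nested_geodesic[OF conjunct1[OF a]]] by (simp add: scaled_perimeter_def)
    moreover have "1 + - 3 * scaled_perimeter \<kappa> (t 0) \<le> exp (- 3 * scaled_perimeter \<kappa> (t 0))"
      by (rule exp_ge_add_one_self)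
    moreover have "exp (- 3 * scaled_perimeter \<kappa> (t 0)) \<le> 1" using calculation(2) by simp
    ultimately show "\<bar>exp (- 3 * scaled_perimeter \<kappa> (t 0)) - 1\<bar> < \<epsilon>" by linarith
  qed
qed

text \<open>\<open>C = 2 * (1 + \<eta>) / \<eta> ^ 4\<close> for a cap of height \<open>\<eta>\<close>, which is \<open>48\<close> for \<open>\<eta> = 1/2\<close>.\<close>
lemma spherical_constant:
  assumes k: "\<kappa> > 0" and t: "nested_triangles \<kappa> t"
  shows "\<exists>C\<ge>1. (\<forall>n x. 2 ^ n * scaled_side \<kappa> (t n) x \<le> scaled_side \<kappa> (t 0) x * exp (C * scaled_perimeter \<kappa> (t 0))) \<and>
     ((\<forall>x. scaled_side \<kappa> (t 0) x < 1) \<longrightarrow> C = 48)"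
proof -
  obtain \<eta> h where h: "norm h = sqrt \<kappa>" and \<eta>: "0 < \<eta>" "\<And>x. \<eta> \<le> h \<bullet> vert (t 0) x"
    and s: "(\<forall>x. scaled_side \<kappa> (t 0) x < 1) \<longrightarrow> \<eta> = 1 / 2"
    using ex_hemisphere_margin[OF k nested_geodesic[OF t]] by blast
  define C where "C = 2 * (1 + \<eta>) / \<eta> ^ 4"
  have "\<eta> \<le> 1"
    using \<eta>(2)[of LA] inner_le_1(1)[OF k vert_in_surface[OF nested_geodesic[OF t]] h, of 0 LA] by simp
  then have "\<eta> ^ 4 \<le> 1" using \<eta>(1) by (simp add: power_le_one)
  then have "C \<ge> 1" unfolding C_def using \<eta>(1) by (simp add: field_simps)
  moreover have "C = 48" if "\<eta> = 1 / 2" unfolding C_def that by (simp add: eval_nat_numeral)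
  ultimately show ?thesis
    using nested_spherical_upper[OF k t h \<eta>, folded C_def] s by (intro exI[of _ C]) auto
qed

text \<open>Since \<open>C t\<close> depends on the position of the triangle in its hemisphere, it must be chosen for each
  sequence; the choice is fixed for small triangles. The added \<open>1\<close> in the exponent makes the inequality strict.\<close>
lemma spherical_case:
  assumes k: "\<kappa> > 0"
  shows "\<exists>L :: (nat \<Rightarrow> triangle) \<Rightarrow> real.
          (\<forall>t. nested_triangles \<kappa> t \<longrightarrow>
             L t > 0 \<and>
             (\<forall>n. side_length \<kappa> (t 0) x \<le> 2 ^ n * side_length \<kappa> (t n) x \<and>
                  2 ^ n * side_length \<kappa> (t n) x \<le> side_length \<kappa> (t 0) x * L t) \<and>
             (nondegenerate (t 0) \<and> (\<exists>k. parallel_step \<kappa> t x k) \<longrightarrow>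
                L t > 1 \<and>
                (\<forall>n. 2 ^ n * side_length \<kappa> (t n) x < side_length \<kappa> (t 0) x * L t) \<and>
                (\<forall>k n. parallel_step \<kappa> t x k \<and> k < n \<longrightarrow>
                   side_length \<kappa> (t 0) x < 2 ^ n * side_length \<kappa> (t n) x))) \<and>
          (\<forall>\<epsilon>>0. \<exists>\<delta>>0. \<forall>t.
             nested_triangles \<kappa> t \<and> (\<exists>k. parallel_step \<kappa> t x k) \<and>
             (\<forall>y. side_length \<kappa> (t 0) y < \<delta>) \<longrightarrow> \<bar>L t - 1\<bar> < \<epsilon>)"
proof -
  have k0: "\<kappa> \<noteq> 0" using k by simp
  define r where "r = sqrt \<bar>\<kappa>\<bar>"
  have r: "r > 0" using k0 by (simp add: r_def)
  note sl = scaled_side_side_length[OF k0, folded r_def]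
  have S0: "0 \<le> scaled_perimeter \<kappa> (t 0)" if "nested_triangles \<kappa> t" for t
    using scaled_side_bounds(1)[OF k0 nested_geodesic[OF that]] by (simp add: scaled_perimeter_def)
  obtain C where C: "\<And>t. nested_triangles \<kappa> t \<Longrightarrow> C t \<ge> 1"
    "\<And>t n x. nested_triangles \<kappa> t \<Longrightarrow>
       2 ^ n * scaled_side \<kappa> (t n) x \<le> scaled_side \<kappa> (t 0) x * exp (C t * scaled_perimeter \<kappa> (t 0))"
    "\<And>t. nested_triangles \<kappa> t \<Longrightarrow> \<forall>x. scaled_side \<kappa> (t 0) x < 1 \<Longrightarrow> C t = 48"
    using spherical_constant[OF k] by metis
  show ?thesis
  proof (intro exI[of _ "\<lambda>t. exp ((C t + 1) * scaled_perimeter \<kappa> (t 0))"] conjI allI impI)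
    show "exp ((C t + 1) * scaled_perimeter \<kappa> (t 0)) > 0" for t by simp
    fix t assume t: "nested_triangles \<kappa> t"
    note t0 = nested_geodesic[OF t, of 0]
    show "side_length \<kappa> (t 0) x \<le> 2 ^ n * side_length \<kappa> (t n) x" for n
      using nested_spherical_lower[OF k t, of 0 n x] r by (simp add: sl divide_right_mono)
    show "2 ^ n * side_length \<kappa> (t n) x \<le> side_length \<kappa> (t 0) x * exp ((C t + 1) * scaled_perimeter \<kappa> (t 0))" for n
    proof -
      note C(2)[OF t, of n x]
      also have "scaled_side \<kappa> (t 0) x * exp (C t * scaled_perimeter \<kappa> (t 0))
          \<le> scaled_side \<kappa> (t 0) x * exp ((C t + 1) * scaled_perimeter \<kappa> (t 0))"
        using S0[OF t] scaled_side_bounds(1)[OF k0 t0] by (intro mult_left_mono) (auto simp: algebra_simps)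
      finally show ?thesis using r by (simp add: sl divide_right_mono)
    qed
    assume nd: "nondegenerate (t 0) \<and> (\<exists>k. parallel_step \<kappa> t x k)"
    note pos = nondegenerate_scaled_side_pos[OF k0 t0 conjunct1[OF nd]]
    have S: "0 < scaled_perimeter \<kappa> (t 0)"
      using pos[of LA] pos[of LB] pos[of LC] by (simp add: scaled_perimeter_def)
    then show "1 < exp ((C t + 1) * scaled_perimeter \<kappa> (t 0))" using C(1)[OF t] by simp
    show "2 ^ n * side_length \<kappa> (t n) x < side_length \<kappa> (t 0) x * exp ((C t + 1) * scaled_perimeter \<kappa> (t 0))" for n
    proof -
      note C(2)[OF t, of n x]
      also have "scaled_side \<kappa> (t 0) x * exp (C t * scaled_perimeter \<kappa> (t 0))
          < scaled_side \<kappa> (t 0) x * exp ((C t + 1) * scaled_perimeter \<kappa> (t 0))"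
        using S pos by (intro mult_strict_left_mono) (auto simp: algebra_simps)
      finally show ?thesis using r by (simp add: sl divide_strict_right_mono)
    qed
    fix m n assume mn: "parallel_step \<kappa> t x m \<and> m < n"
    have "scaled_side \<kappa> (t (Suc m)) x \<noteq> scaled_side \<kappa> (t m) x / 2"
      by (rule nested_parallel_ne[OF k0 t]) (use nd mn in auto)
    moreover define f where "f j = 2 ^ j * scaled_side \<kappa> (t j) x" for j
    ultimately have "f (Suc m) \<noteq> f m" by simp
    moreover have "f (Suc m) \<le> f n" "f m \<le> f (Suc m)" "f 0 \<le> f m"
      unfolding f_def using mn by (intro nested_spherical_lower[OF k t]; simp)+
    ultimately have "f 0 < f n" by linarith
    then have "scaled_side \<kappa> (t 0) x < 2 ^ n * scaled_side \<kappa> (t n) x" by (simp add: f_def)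
    then show "side_length \<kappa> (t 0) x < 2 ^ n * side_length \<kappa> (t n) x"
      using r by (simp add: sl divide_strict_right_mono)
  next
    fix \<epsilon> :: real assume e: "\<epsilon> > 0"
    \<comment> \<open>The scaled perimeter is below \<open>3 * d\<close>, and \<open>147 = 3 * (48 + 1)\<close>.
      The bound \<open>1\<close> makes the triangle small in the sense of \<open>C(3)\<close>.\<close>
    define d where "d = min 1 (ln (1 + \<epsilon>) / 147)"
    have d: "0 < d" "d \<le> 1" "147 * d \<le> ln (1 + \<epsilon>)" using e by (auto simp: d_def)
    show "\<exists>\<delta>>0. \<forall>t. nested_triangles \<kappa> t \<and> (\<exists>k. parallel_step \<kappa> t x k) \<and>
        (\<forall>y. side_length \<kappa> (t 0) y < \<delta>) \<longrightarrow> \<bar>exp ((C t + 1) * scaled_perimeter \<kappa> (t 0)) - 1\<bar> < \<epsilon>"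
    proof (intro exI[of _ "d / r"] conjI allI impI)
      show "d / r > 0" using d r by simp
      fix t assume a: "nested_triangles \<kappa> t \<and> (\<exists>k. parallel_step \<kappa> t x k) \<and>
        (\<forall>y. side_length \<kappa> (t 0) y < d / r)"
      then have t: "nested_triangles \<kappa> t" by simp
      have lt: "scaled_side \<kappa> (t 0) y < d" for y
        using a r by (simp add: scaled_side_def r_def[symmetric] field_simps)
      then have "\<forall>y. scaled_side \<kappa> (t 0) y < 1" using d(2) by (meson less_le_trans)
      then have C48: "C t = 48" by (rule C(3)[OF t])
      have "49 * scaled_perimeter \<kappa> (t 0) < ln (1 + \<epsilon>)"
        using lt[of LA] lt[of LB] lt[of LC] d(3) by (simp add: scaled_perimeter_def)
      then have "exp (49 * scaled_perimeter \<kappa> (t 0)) < exp (ln (1 + \<epsilon>))" by (simp only: exp_less_mono)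
      moreover have "1 \<le> exp (49 * scaled_perimeter \<kappa> (t 0))" using S0[OF t] by simp
      ultimately show "\<bar>exp ((C t + 1) * scaled_perimeter \<kappa> (t 0)) - 1\<bar> < \<epsilon>"
        using e by (simp add: C48)
    qed
  qed
qed

theorem theoremC:
  fixes \<kappa> :: real
  shows
    "(\<kappa> < 0 \<longrightarrow>
       (\<forall>x. \<exists>l :: (nat \<Rightarrow> triangle) \<Rightarrow> real.
          (\<forall>t. nested_triangles \<kappa> t \<longrightarrow>
             l t > 0 \<and>
             (\<forall>n. side_length \<kappa> (t 0) x * l t \<le> 2 ^ n * side_length \<kappa> (t n) x \<and>
                  2 ^ n * side_length \<kappa> (t n) x \<le> side_length \<kappa> (t 0) x) \<and>
             (nondegenerate (t 0) \<and> (\<exists>k. parallel_step \<kappa> t x k) \<longrightarrow>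
                l t < 1 \<and>
                (\<forall>n. side_length \<kappa> (t 0) x * l t < 2 ^ n * side_length \<kappa> (t n) x) \<and>
                (\<forall>k n. parallel_step \<kappa> t x k \<and> k < n \<longrightarrow>
                   2 ^ n * side_length \<kappa> (t n) x < side_length \<kappa> (t 0) x))) \<and>
          (\<forall>\<epsilon>>0. \<exists>\<delta>>0. \<forall>t.
             nested_triangles \<kappa> t \<and> (\<exists>k. parallel_step \<kappa> t x k) \<and>
             (\<forall>y. side_length \<kappa> (t 0) y < \<delta>) \<longrightarrow> \<bar>l t - 1\<bar> < \<epsilon>))) \<and>
     (\<kappa> > 0 \<longrightarrow>
       (\<forall>x. \<exists>L :: (nat \<Rightarrow> triangle) \<Rightarrow> real.
          (\<forall>t. nested_triangles \<kappa> t \<longrightarrow>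
             L t > 0 \<and>
             (\<forall>n. side_length \<kappa> (t 0) x \<le> 2 ^ n * side_length \<kappa> (t n) x \<and>
                  2 ^ n * side_length \<kappa> (t n) x \<le> side_length \<kappa> (t 0) x * L t) \<and>
             (nondegenerate (t 0) \<and> (\<exists>k. parallel_step \<kappa> t x k) \<longrightarrow>
                L t > 1 \<and>
                (\<forall>n. 2 ^ n * side_length \<kappa> (t n) x < side_length \<kappa> (t 0) x * L t) \<and>
                (\<forall>k n. parallel_step \<kappa> t x k \<and> k < n \<longrightarrow>
                   side_length \<kappa> (t 0) x < 2 ^ n * side_length \<kappa> (t n) x))) \<and>
          (\<forall>\<epsilon>>0. \<exists>\<delta>>0. \<forall>t.
             nested_triangles \<kappa> t \<and> (\<exists>k. parallel_step \<kappa> t x k) \<and>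
             (\<forall>y. side_length \<kappa> (t 0) y < \<delta>) \<longrightarrow> \<bar>L t - 1\<bar> < \<epsilon>)))"
  using hyperbolic_case spherical_case by blast

end
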